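(* Let $(\mathcal S,\gamma)$ be an IFS arc in $\mathbb{R}^n$. Then $\gamma$ has bounded turning if and only if both of the following hold: (1) there exist constants $r_0>0$ and $C_1,C_2>0$ such that for every open set $U\subseteq\mathbb{R}^n$ with $U\cap\gamma\neq\emptyset$ and $0<\operatorname{diam}(U\cap\gamma)<r_0$ there is a map $\varphi:U\cap\gamma\to\gamma$ with $$\frac{C_1|a-b|}{\operatorname{diam}(U\cap\gamma)}\le|\varphi(a)-\varphi(b)|\le\frac{C_2|a-b|}{\operatorname{diam}(U\cap\gamma)}\quad\text{for all }a,b\in U\cap\gamma;$$ (2) there exist constants $r_1>0$ and $C_3>0$ such that for every $x\in\gamma$ and $0<r<r_1$ there is a map $\psi:\gamma\to B(x,r)\cap\gamma$ with $|\psi(a)-\psi(b)|\ge C_3\,r\,|a-b|$ for all $a,b\in\gamma$.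
   Context: $\mathcal S=\{S_1,\dots,S_N\}$, $N\ge2$, contracting similarities of $\mathbb{R}^n$, invariant set $\gamma$ (unique nonempty compact set with $\gamma=\bigcup_iS_i(\gamma)$). IFS path: there are $a,b$ with $S_1(a)=a$, $S_N(b)=b$, $S_i(b)=S_{i+1}(a)$ for $i=1,\dots,N-1$. IFS arc: moreover $S_i(\gamma)\cap S_{i+1}(\gamma)=\{S_{i+1}(a)\}$ for $i=1,\dots,N-1$ and $S_i(\gamma)\cap S_j(\gamma)=\emptyset$ for $i,j\in\{1,\dots,N\}$, $|i-j|>1$. $\gamma$ has bounded turning if there is $C\ge1$ such that any distinct $p,q\in\gamma$ lie in a continuum $E\subseteq\gamma$ with $\operatorname{diam}E\le C|p-q|$. $B(x,r)$ is the open Euclidean ball. *)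

theory Defs
  imports "HOL-Analysis.Analysis"
begin

definition contracting_similarity :: "('a::euclidean_space \<Rightarrow> 'a) \<Rightarrow> bool" where
  "contracting_similarity f \<longleftrightarrow>
     (\<exists>r. 0 < r \<and> r < 1 \<and> (\<forall>x y. dist (f x) (f y) = r * dist x y))"

definition IFS_invariant :: "nat \<Rightarrow> (nat \<Rightarrow> 'a::euclidean_space \<Rightarrow> 'a) \<Rightarrow> 'a set \<Rightarrow> bool" where
  "IFS_invariant N S \<gamma> \<longleftrightarrow>
     2 \<le> N \<and> (\<forall>i\<in>{1..N}. contracting_similarity (S i)) \<and>
     compact \<gamma> \<and> \<gamma> \<noteq> {} \<and> \<gamma> = (\<Union>i\<in>{1..N}. S i ` \<gamma>)"

definition IFS_path :: "nat \<Rightarrow> (nat \<Rightarrow> 'a::euclidean_space \<Rightarrow> 'a) \<Rightarrow> 'a set \<Rightarrow> 'a \<Rightarrow> 'a \<Rightarrow> bool" where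
  "IFS_path N S \<gamma> a b \<longleftrightarrow> IFS_invariant N S \<gamma> \<and>
     S 1 a = a \<and> S N b = b \<and> (\<forall>i\<in>{1..N-1}. S i b = S (Suc i) a)"

definition IFS_arc :: "nat \<Rightarrow> (nat \<Rightarrow> 'a::euclidean_space \<Rightarrow> 'a) \<Rightarrow> 'a set \<Rightarrow> bool" where
  "IFS_arc N S \<gamma> \<longleftrightarrow> (\<exists>a b. IFS_path N S \<gamma> a b \<and>
     (\<forall>i\<in>{1..N-1}. S i ` \<gamma> \<inter> S (Suc i) ` \<gamma> = {S (Suc i) a}) \<and>
     (\<forall>i\<in>{1..N}. \<forall>j\<in>{1..N}. 1 < (if i \<le> j then j - i else i - j) \<longrightarrow>
         S i ` \<gamma> \<inter> S j ` \<gamma> = {}))"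

definition bounded_turning :: "'a::metric_space set \<Rightarrow> bool" where
  "bounded_turning \<gamma> \<longleftrightarrow> (\<exists>C\<ge>1. \<forall>p\<in>\<gamma>. \<forall>q\<in>\<gamma>. p \<noteq> q \<longrightarrow>
     (\<exists>E. E \<subseteq> \<gamma> \<and> compact E \<and> connected E \<and> p \<in> E \<and> q \<in> E \<and>
          diameter E \<le> C * dist p q))"

end

theory Submission
  imports Defs
begin

text \<open>
  Let \<open>z\<^sub>i = S\<^sub>i b = S\<^sub>i\<^sub>+\<^sub>1 a\<close>. Bounded turning and condition (1) are both equivalent to the estimate
  \<open>\<bar>p - z\<^sub>i\<bar> \<le> C \<bar>p - q\<bar>\<close> for \<open>p \<in> S\<^sub>i \<gamma>\<close> and \<open>q \<in> S\<^sub>i\<^sub>+\<^sub>1 \<gamma>\<close>, while condition (2) always holds: small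
  copies of \<open>\<gamma>\<close> sit near each of its points.
  Pulling back by the \<open>S\<^sub>i\<close> reduces every claim to pairs or sets not contained in one cell. There
  the only difficulty is near a junction, where both sides are rescaled separately by powers of
  \<open>S\<^sub>N\<close> and \<open>S\<^sub>1\<close>; the estimate says exactly that the two rescalings fit together.
\<close>

text \<open>Why the reduction to one level loses nothing: a claim at scale \<open>s\<close> follows
  from the claims at the scales \<open>s / r i\<close>, which grow at least geometrically, and above
  the diameter it is trivial. The estimates are homogeneous, so constants found at the first level
  that splits a pair or a set survive every pull-back unchanged. At that level non-adjacent cells
  have a positive gap, and adjacent ones meet in one point. Connectedness has no scale of its own.
  It gets one through truth-valued functions that do not change below some distance
  \<open>e\<close>; they rescale with the cells. The rest of the topology comes from one fact: each
  junction cuts \<gamma>, so a connected subset reaching both sides contains it. This turns a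
  continuum of controlled diameter into the estimate at the junction.\<close>

section \<open>Connectedness, cut points and gaps in general spaces\<close>

text \<open>Two closed parts separating a compact set have a positive distance \<open>d\<close>, so
  membership in one of them does not change below distance \<open>d\<close>. This form of
  connectedness is accessible to \<open>scale_induct\<close>.\<close>

lemma connected_compactI:
  fixes X :: "'a::heine_borel set"
  assumes "compact X"
    and const: "\<And>e f. 0 < e \<Longrightarrow> (\<And>x y. x \<in> X \<Longrightarrow> y \<in> X \<Longrightarrow> dist x y < e \<Longrightarrow> f x = (f y :: bool))
                  \<Longrightarrow> \<forall>x\<in>X. \<forall>y\<in>X. f x = f y"
  shows "connected X"
proof (rule ccontr)
  assume "\<not> connected X"
  then obtain A B where AB: "closed A" "closed B" "X \<subseteq> A \<union> B" "A \<inter> B \<inter> X = {}"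
      "A \<inter> X \<noteq> {}" "B \<inter> X \<noteq> {}"
    by (auto simp: connected_closed)
  have "compact (X \<inter> A)" "closed (X \<inter> B)" "(X \<inter> A) \<inter> (X \<inter> B) = {}"
    using AB assms(1) by (auto intro: compact_Int_closed closed_Int compact_imp_closed)
  then obtain d where d: "d > 0" "\<forall>x\<in>X \<inter> A. \<forall>y\<in>X \<inter> B. d \<le> dist x y"
    using separate_compact_closed by blast
  have *: "y \<in> A" if "x \<in> X" "y \<in> X" "dist x y < d" "x \<in> A" for x y
  proof (rule ccontr)
    assume "y \<notin> A"
    then have "d \<le> dist x y" using that d(2) AB(3) by blast
    then show False using that by simp
  qed
  have "\<forall>x\<in>X. \<forall>y\<in>X. (x \<in> A) = (y \<in> A)"
    using * by (intro const[OF d(1)]) (metis dist_commute)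
  then show False
    using AB by blast
qed

lemma cut_point_mem_connected:
  assumes "connected P" "P \<subseteq> A \<union> B" "closed A" "closed B" "A \<inter> B \<subseteq> {z}"
    and "P \<inter> A \<noteq> {}" "P \<inter> B \<noteq> {}"
  shows "z \<in> P"
proof (rule ccontr)
  assume "z \<notin> P"
  then have "A \<inter> B \<inter> P = {}" using assms(5) by blast
  then show False
    using assms unfolding connected_closed by blast
qed

text \<open>In a separation of \<open>P \<inter> A\<close> one part does not contain
  \<open>z\<close>. Adding all of \<open>B\<close> to the other part gives a separation of
  \<open>P\<close>.\<close>

lemma connected_Int_cut:
  assumes "connected P" "P \<subseteq> A \<union> B" "closed A" "closed B" "A \<inter> B \<subseteq> {z}"
  shows "connected (P \<inter> A)"
proof (rule ccontr)
  assume "\<not> connected (P \<inter> A)"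
  then obtain C D where CD: "closed C" "closed D" "P \<inter> A \<subseteq> C \<union> D" "C \<inter> D \<inter> (P \<inter> A) = {}"
      "C \<inter> (P \<inter> A) \<noteq> {}" "D \<inter> (P \<inter> A) \<noteq> {}"
    by (auto simp: connected_closed)
  have *: False if "closed C" "closed D" "P \<inter> A \<subseteq> C \<union> D" "C \<inter> D \<inter> (P \<inter> A) = {}"
      "C \<inter> (P \<inter> A) \<noteq> {}" "D \<inter> (P \<inter> A) \<noteq> {}" "z \<notin> D \<inter> (P \<inter> A)" for C D
  proof -
    have "closed (D \<inter> A)" "closed (C \<inter> A \<union> B)"
      using that assms by auto
    moreover have "P \<subseteq> (D \<inter> A) \<union> (C \<inter> A \<union> B)" "(D \<inter> A) \<inter> (C \<inter> A \<union> B) \<inter> P = {}"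
      using that assms(2,5) by auto
    moreover have "(D \<inter> A) \<inter> P \<noteq> {}" "(C \<inter> A \<union> B) \<inter> P \<noteq> {}"
      using that by auto
    ultimately show False
      using assms(1) unfolding connected_closed by blast
  qed
  show False
  proof (cases "z \<in> D \<inter> (P \<inter> A)")
    case True
    then have "z \<notin> C \<inter> (P \<inter> A)" using CD(4) by blast
    with *[of D C] CD show False by blast
  next
    case False
    with *[of C D] CD show False by blast
  qed
qed

lemma finite_compact_gap:
  fixes F :: "'a::heine_borel set set"
  assumes "finite F" "\<And>A. A \<in> F \<Longrightarrow> compact A"
  obtains d where "d > 0"
    "\<And>A B x y. \<lbrakk>A \<in> F; B \<in> F; A \<inter> B = {}; x \<in> A; y \<in> B\<rbrakk> \<Longrightarrow> d \<le> dist x y"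
proof -
  have "\<exists>d>0. A \<inter> B = {} \<longrightarrow> (\<forall>x\<in>A. \<forall>y\<in>B. d \<le> dist x y)" if "A \<in> F" "B \<in> F" for A B
    using separate_compact_closed[of A B] assms(2) that compact_imp_closed
    by (metis zero_less_one)
  then have "\<forall>p\<in>F\<times>F. \<exists>d>0. fst p \<inter> snd p = {} \<longrightarrow> (\<forall>x\<in>fst p. \<forall>y\<in>snd p. d \<le> dist x y)"
    by auto
  then obtain d where d: "\<And>p. p \<in> F \<times> F \<Longrightarrow> d p > 0 \<and>
      (fst p \<inter> snd p = {} \<longrightarrow> (\<forall>x\<in>fst p. \<forall>y\<in>snd p. d p \<le> dist x y))"
    by metis
  define m where "m = Min (insert 1 (d ` (F \<times> F)))"
  have fin: "finite (insert 1 (d ` (F \<times> F)))" using assms(1) by simp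
  have "m > 0" unfolding m_def using fin d by (subst Min_gr_iff) auto
  moreover have "m \<le> dist x y" if "A \<in> F" "B \<in> F" "A \<inter> B = {}" "x \<in> A" "y \<in> B" for A B x y
  proof -
    have "m \<le> d (A,B)" unfolding m_def using fin that by (intro Min_le) auto
    also have "\<dots> \<le> dist x y" using d[of "(A,B)"] that by auto
    finally show ?thesis .
  qed
  ultimately show ?thesis using that by blast
qed

lemma diameter_similar_image:
  fixes f :: "'a::metric_space \<Rightarrow> 'b::metric_space"
  assumes sim: "\<And>x y. x \<in> W \<Longrightarrow> y \<in> W \<Longrightarrow> dist (f x) (f y) = c * dist x y"
    and "bounded W" "0 < c"
  shows "diameter (f ` W) = c * diameter W"
proof (cases "W = {}")
  case False
  have le: "dist x y \<le> diameter W" if "x \<in> W" "y \<in> W" for x y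
    using diameter_bounded_bound[OF assms(2)] that by blast
  have D0: "0 \<le> diameter W" using diameter_ge_0 assms(2) by blast
  have bd: "bounded (f ` W)"
    unfolding bounded_two_points
    using sim le assms(3) by (intro exI[of _ "c * diameter W"]) auto
  have "diameter (f ` W) \<le> c * diameter W"
    unfolding diameter_def using False sim le assms(3)
    by (auto intro!: cSUP_least simp: diameter_def)
  moreover have "diameter W \<le> diameter (f ` W) / c"
  proof -
    have "dist x y \<le> diameter (f ` W) / c" if "x \<in> W" "y \<in> W" for x y
      using diameter_bounded_bound[OF bd, of "f x" "f y"] that sim assms(3)
      by (simp add: field_simps)
    then show ?thesis
      using False by (subst diameter_def) (auto intro!: cSUP_least)
  qed
  ultimately show ?thesis using assms(3) by (simp add: field_simps)
qed (simp add: diameter_def)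

section \<open>Cells, pull-backs and induction on scales\<close>

text \<open>Assuming \<open>a \<noteq> b\<close> leaves out exactly the case that \<gamma> is a
  point. It makes \<open>diam\<close> positive and keeps \<open>a\<close> and \<open>b\<close> out
  of all cells but the first and the last.\<close>

locale nondegenerate_IFS_arc =
  fixes N :: nat and S :: "nat \<Rightarrow> 'a::euclidean_space \<Rightarrow> 'a" and \<gamma> :: "'a set"
    and a b :: 'a and r :: "nat \<Rightarrow> real"
  assumes N2: "2 \<le> N"
    and r_pos: "i \<in> {1..N} \<Longrightarrow> 0 < r i" and r_less: "i \<in> {1..N} \<Longrightarrow> r i < 1"
    and sim: "i \<in> {1..N} \<Longrightarrow> dist (S i x) (S i y) = r i * dist x y"
    and comp: "compact \<gamma>" and nonempty: "\<gamma> \<noteq> {}"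
    and invariant: "\<gamma> = (\<Union>i\<in>{1..N}. S i ` \<gamma>)"
    and fix_a: "S 1 a = a" and fix_b: "S N b = b"
    and junction: "i \<in> {1..N-1} \<Longrightarrow> S i b = S (Suc i) a"
    and adjacent: "i \<in> {1..N-1} \<Longrightarrow> S i ` \<gamma> \<inter> S (Suc i) ` \<gamma> = {S (Suc i) a}"
    and disjoint_cells: "\<lbrakk>i \<in> {1..N}; j \<in> {1..N}; Suc i < j\<rbrakk> \<Longrightarrow> S i ` \<gamma> \<inter> S j ` \<gamma> = {}"
    and a_ne_b: "a \<noteq> b"
begin

abbreviation cell :: "nat \<Rightarrow> 'a set" where "cell i \<equiv> S i ` \<gamma>"
abbreviation pull :: "nat \<Rightarrow> 'a \<Rightarrow> 'a" where "pull i \<equiv> inv_into \<gamma> (S i)"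
abbreviation diam :: real where "diam \<equiv> diameter \<gamma>"

definition \<rho> :: real where "\<rho> = Max (r ` {1..N})"
definition \<mu> :: real where "\<mu> = Min (r ` {1..N})"

lemma \<rho>: "0 < \<rho>" "\<rho> < 1" "i \<in> {1..N} \<Longrightarrow> r i \<le> \<rho>"
proof -
  have *: "finite (r ` {1..N})" "r ` {1..N} \<noteq> {}" using N2 by auto
  show "\<rho> < 1" using Max_in[OF *] r_less unfolding \<rho>_def by auto
  show "0 < \<rho>" using Max_in[OF *] r_pos unfolding \<rho>_def by auto
  show "i \<in> {1..N} \<Longrightarrow> r i \<le> \<rho>" using * unfolding \<rho>_def by (intro Max_ge) auto
qed

lemma \<mu>: "0 < \<mu>" "\<mu> < 1" "i \<in> {1..N} \<Longrightarrow> \<mu> \<le> r i"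
proof -
  have *: "finite (r ` {1..N})" "r ` {1..N} \<noteq> {}" using N2 by auto
  show "\<mu> < 1" using Min_in[OF *] r_less unfolding \<mu>_def by auto
  show "0 < \<mu>" using Min_in[OF *] r_pos unfolding \<mu>_def by auto
  show "i \<in> {1..N} \<Longrightarrow> \<mu> \<le> r i" using * unfolding \<mu>_def by (intro Min_le) auto
qed

text \<open>\<open>S i\<close> would move a nearest point of \<gamma> to \<open>c\<close> within
  \<gamma> and closer to \<open>c\<close>, unless its distance is \<open>0\<close>.\<close>

lemma fixed_point_mem:
  assumes "i \<in> {1..N}" "S i c = c"
  shows "c \<in> \<gamma>"
proof -
  obtain x where x: "x \<in> \<gamma>" "\<And>y. y \<in> \<gamma> \<Longrightarrow> dist c x \<le> dist c y"
    using distance_attains_inf[OF compact_imp_closed[OF comp] nonempty] by blast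
  have "S i x \<in> \<gamma>" using x(1) assms(1) invariant by blast
  then have "dist c x \<le> r i * dist c x"
    using x(2)[OF \<open>S i x \<in> \<gamma>\<close>] sim[OF assms(1), of c x] assms(2) by simp
  then have "dist c x = 0"
    using r_less[OF assms(1)] mult_strict_right_mono[of "r i" 1 "dist c x"]
      zero_le_dist[of c x] by argo
  then show ?thesis using x(1) by simp
qed

lemma a_mem: "a \<in> \<gamma>" and b_mem: "b \<in> \<gamma>"
  using fixed_point_mem[OF _ fix_a] fixed_point_mem[OF _ fix_b] N2 by auto

lemma dist_le_diam: "x \<in> \<gamma> \<Longrightarrow> y \<in> \<gamma> \<Longrightarrow> dist x y \<le> diam"
  using diameter_bounded_bound[OF compact_imp_bounded[OF comp]] by blast

lemma diam_pos: "0 < diam"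
  using dist_le_diam[OF a_mem b_mem] a_ne_b zero_less_dist_iff[of a b] by linarith

lemma cell_subset: "i \<in> {1..N} \<Longrightarrow> cell i \<subseteq> \<gamma>"
  using invariant by blast

lemma cellE:
  assumes "x \<in> \<gamma>" obtains i where "i \<in> {1..N}" "x \<in> cell i"
  using assms invariant by blast

lemma continuous_S: "i \<in> {1..N} \<Longrightarrow> continuous_on X (S i)"
  using sim[of i] r_pos[of i]
  by (intro lipschitz_on_continuous_on[of "r i"] lipschitz_onI) auto

lemma compact_cell: "i \<in> {1..N} \<Longrightarrow> compact (cell i)"
  using comp continuous_S compact_continuous_image by blast

lemma inj_S: "i \<in> {1..N} \<Longrightarrow> inj_on (S i) X"
  using sim[of i] r_pos[of i] by (intro inj_onI) (metis dist_eq_0_iff less_irrefl mult_eq_0_iff)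

lemma pull_mem: "x \<in> cell i \<Longrightarrow> pull i x \<in> \<gamma>"
  by (rule inv_into_into)

lemma S_pull: "x \<in> cell i \<Longrightarrow> S i (pull i x) = x"
  by (rule f_inv_into_f)

lemma pull_S: "i \<in> {1..N} \<Longrightarrow> x \<in> \<gamma> \<Longrightarrow> pull i (S i x) = x"
  by (rule inv_into_f_f[OF inj_S])

lemma dist_pull:
  assumes "i \<in> {1..N}" "x \<in> cell i" "y \<in> cell i"
  shows "dist (pull i x) (pull i y) = dist x y / r i"
  using sim[OF assms(1), of "pull i x" "pull i y"] S_pull assms r_pos[OF assms(1)]
  by (simp add: field_simps)

lemma continuous_pull: "i \<in> {1..N} \<Longrightarrow> X \<subseteq> cell i \<Longrightarrow> continuous_on X (pull i)"
  using dist_pull[of i] r_pos[of i]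
  by (intro lipschitz_on_continuous_on[of "1 / r i"] lipschitz_onI) (auto simp: subset_iff)

text \<open>Passing from \<open>s\<close> to \<open>s / r i\<close> multiplies the scale by at least
  \<open>1 / \<rho> > 1\<close>, so finitely many passages bring it above \<open>diam\<close>; their
  number is the \<open>n\<close> of the inner induction.\<close>

lemma scale_induct [consumes 1, case_names large small]:
  assumes "0 < s"
    and base: "\<And>s. diam < s \<Longrightarrow> P s"
    and step: "\<And>s. 0 < s \<Longrightarrow> s \<le> diam \<Longrightarrow> (\<And>i. i \<in> {1..N} \<Longrightarrow> P (s / r i)) \<Longrightarrow> P s"
  shows "P s"
proof -
  have "P s" if "0 < s" "\<rho> ^ n * diam < s" for n s
    using that
  proof (induction n arbitrary: s)
    case 0
    then show ?case using base by simp
  next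
    case (Suc n)
    show ?case
    proof (cases "diam < s")
      case False
      have "P (s / r i)" if i: "i \<in> {1..N}" for i
      proof (rule Suc.IH)
        show "0 < s / r i" using Suc.prems r_pos[OF i] by simp
        have "\<rho> ^ n * diam * r i \<le> \<rho> ^ n * diam * \<rho>"
          using \<rho> i diam_pos by (intro mult_left_mono) auto
        then show "\<rho> ^ n * diam < s / r i"
          using Suc.prems(2) r_pos[OF i] by (simp add: field_simps)
      qed
      with step Suc.prems(1) False show ?thesis by simp
    qed (rule base)
  qed
  moreover obtain n where "\<rho> ^ n < s / diam"
    using real_arch_pow_inv[of "s / diam" \<rho>] \<rho>(2) assms(1) diam_pos by auto
  ultimately show ?thesis
    using assms(1) diam_pos by (simp add: field_simps)
qed

section \<open>Junctions as cut points of \<gamma>\<close>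

definition z :: "nat \<Rightarrow> 'a" where "z i = S i b"

lemma z_Suc: "i \<in> {1..N-1} \<Longrightarrow> z i = S (Suc i) a"
  unfolding z_def by (rule junction)

lemma z_mem: "i \<in> {1..N-1} \<Longrightarrow> z i \<in> cell i" "i \<in> {1..N-1} \<Longrightarrow> z i \<in> cell (Suc i)"
  "i \<in> {1..N-1} \<Longrightarrow> z i \<in> \<gamma>"
proof -
  show "i \<in> {1..N-1} \<Longrightarrow> z i \<in> cell i" using b_mem unfolding z_def by simp
  then show "i \<in> {1..N-1} \<Longrightarrow> z i \<in> \<gamma>" using cell_subset[of i] by fastforce
  show "i \<in> {1..N-1} \<Longrightarrow> z i \<in> cell (Suc i)" using a_mem z_Suc by simp
qed

lemma adjacent_z: "i \<in> {1..N-1} \<Longrightarrow> cell i \<inter> cell (Suc i) = {z i}"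
  using adjacent z_Suc by simp

definition lower :: "nat \<Rightarrow> 'a set" where "lower i = (\<Union>j\<in>{1..i}. cell j)"
definition upper :: "nat \<Rightarrow> 'a set" where "upper i = (\<Union>j\<in>{i..N}. cell j)"

lemma closed_lower: "i \<le> N \<Longrightarrow> closed (lower i)"
  unfolding lower_def by (intro closed_UN) (auto intro!: compact_imp_closed compact_cell)

lemma closed_upper: "1 \<le> i \<Longrightarrow> closed (upper i)"
  unfolding upper_def by (intro closed_UN) (auto intro!: compact_imp_closed compact_cell)

lemma lower_Un_upper: "i \<le> N \<Longrightarrow> \<gamma> = lower i \<union> upper (Suc i)"
proof -
  assume "i \<le> N"
  then have "{1..N} = {1..i} \<union> {Suc i..N}" by auto
  then show ?thesis unfolding lower_def upper_def by (subst invariant) (metis UN_Un)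
qed

lemma cells_meet_adjacent:
  assumes "i \<in> {1..N}" "j \<in> {1..N}" "i < j" "cell i \<inter> cell j \<noteq> {}"
  shows "j = Suc i"
  using disjoint_cells[of i j] assms by (metis Suc_lessI)

text \<open>A common point lies in cells \<open>j \<le> i < k\<close>, which must be adjacent; only
  \<open>j = i\<close> and \<open>k = Suc i\<close> remain.\<close>

lemma lower_Int_upper:
  assumes "i \<in> {1..N-1}"
  shows "lower i \<inter> upper (Suc i) \<subseteq> {z i}"
proof
  fix x assume "x \<in> lower i \<inter> upper (Suc i)"
  then obtain j k where jk: "j \<in> {1..i}" "k \<in> {Suc i..N}" "x \<in> cell j" "x \<in> cell k"
    unfolding lower_def upper_def by blast
  then have "k = Suc j"
    using cells_meet_adjacent[of j k] assms by force
  then have "j = i" "k = Suc i" using jk by auto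
  then show "x \<in> {z i}" using jk adjacent_z[OF assms] by blast
qed

text \<open>Replaces the intermediate value theorem along a parametrized arc.\<close>

lemma z_mem_connected:
  assumes "connected P" "P \<subseteq> \<gamma>" "x \<in> P" "x \<in> cell i" "y \<in> P" "y \<in> cell j"
    and "1 \<le> i" "i \<le> k" "k < j" "j \<le> N"
  shows "z k \<in> P"
proof (rule cut_point_mem_connected)
  have k: "k \<in> {1..N-1}" using assms by auto
  have "k \<le> N" using assms by simp
  then show "P \<subseteq> lower k \<union> upper (Suc k)" using lower_Un_upper[of k] assms(2) by simp
  show "lower k \<inter> upper (Suc k) \<subseteq> {z k}" using lower_Int_upper[OF k] .
  show "closed (lower k)" "closed (upper (Suc k))"
    using closed_lower closed_upper k by auto
  show "P \<inter> lower k \<noteq> {}" "P \<inter> upper (Suc k) \<noteq> {}"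
  proof -
    have "i \<in> {1..k}" "j \<in> {Suc k..N}" using assms by auto
    then show "P \<inter> lower k \<noteq> {}" "P \<inter> upper (Suc k) \<noteq> {}"
      using assms(3-6) unfolding lower_def upper_def by blast+
  qed
qed (rule assms)

text \<open>Cuts at \<open>z i\<close> and \<open>z (i - 1)\<close> isolate the cell, since
  \<open>lower i \<inter> upper i = cell i\<close>. For \<open>i = N\<close> or \<open>i = 1\<close>
  one of the cuts is absent.\<close>

lemma connected_Int_cell:
  assumes "connected P" "P \<subseteq> \<gamma>" "i \<in> {1..N}"
  shows "connected (P \<inter> cell i)"
proof -
  have 1: "connected (P \<inter> lower i)"
  proof (cases "i = N")
    case True
    then have "lower i = \<gamma>" unfolding lower_def using invariant by simp
    then show ?thesis using assms by (simp add: Int_absorb2)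
  next
    case False
    then have "i \<in> {1..N-1}" using assms by auto
    then show ?thesis
      using assms lower_Un_upper[of i] closed_lower[of i] closed_upper[of "Suc i"]
        lower_Int_upper[of i]
      by (intro connected_Int_cut[of P "lower i" "upper (Suc i)" "z i"]) auto
  qed
  have 2: "P \<inter> lower i \<inter> upper i = P \<inter> cell i"
  proof -
    have "lower i \<inter> upper i = cell i"
    proof
      show "cell i \<subseteq> lower i \<inter> upper i" using assms(3) unfolding lower_def upper_def by auto
      show "lower i \<inter> upper i \<subseteq> cell i"
      proof
        fix x assume "x \<in> lower i \<inter> upper i"
        then obtain j k where jk: "j \<in> {1..i}" "k \<in> {i..N}" "x \<in> cell j" "x \<in> cell k"
          unfolding lower_def upper_def by blast
        show "x \<in> cell i"
        proof (cases "j = k")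
          case False
          then have "k = Suc j"
            using cells_meet_adjacent[of j k] assms jk by force
          then have "j = i \<or> k = i" using jk by auto
          then show ?thesis using jk by blast
        qed (use jk in auto)
      qed
    qed
    then show ?thesis by blast
  qed
  show ?thesis
  proof (cases "i = 1")
    case True
    then have "upper i = \<gamma>" unfolding upper_def using invariant by simp
    then show ?thesis using 1 2 assms(2) by (metis Int_absorb2 Int_assoc Int_commute)
  next
    case False
    define k where "k = i - 1"
    have k: "k \<in> {1..N-1}" "Suc k = i" using False assms unfolding k_def by auto
    have "connected ((P \<inter> lower i) \<inter> upper (Suc k))"
      using assms lower_Un_upper[of k] closed_lower[of k] closed_upper[of "Suc k"]
        lower_Int_upper[of k] 1 k
      by (intro connected_Int_cut[of _ "upper (Suc k)" "lower k" "z k"]) auto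
    then show ?thesis using 2 k by simp
  qed
qed

section \<open>Connectedness by induction on scales\<close>

text \<open>The gluing step of the inductions: consecutive cells share \<open>z k\<close>, which
  \<open>zX\<close> puts into \<open>X\<close>, so the value of \<open>f\<close> is handed on from
  cell to cell.\<close>

lemma const_on_chain:
  fixes f :: "'a \<Rightarrow> bool"
  assumes "X \<subseteq> \<gamma>"
    and const: "\<And>i x y. \<lbrakk>i \<in> {1..N}; x \<in> X \<inter> cell i; y \<in> X \<inter> cell i\<rbrakk> \<Longrightarrow> f x = f y"
    and zX: "\<And>i j k x y. \<lbrakk>x \<in> X \<inter> cell i; y \<in> X \<inter> cell j; 1 \<le> i; i \<le> k; k < j; j \<le> N\<rbrakk> \<Longrightarrow> z k \<in> X"
  shows "\<forall>x\<in>X. \<forall>y\<in>X. f x = f y"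
proof -
  have *: "f x = f y" if "i \<le> j" "1 \<le> i" "j \<le> N" "x \<in> X \<inter> cell i" "y \<in> X \<inter> cell j" for i j x y
    using that
  proof (induction j arbitrary: y rule: dec_induct)
    case base
    then show ?case using const[of i x y] by auto
  next
    case (step j)
    then have "z j \<in> X" using zX[of x i y "Suc j" j] by auto
    moreover have "z j \<in> cell j" "z j \<in> cell (Suc j)" using z_mem[of j] step by auto
    ultimately show ?case
      using step.IH[of "z j"] step const[of "Suc j" "z j" y] by auto
  qed
  show ?thesis
  proof (intro ballI)
    fix x y assume "x \<in> X" "y \<in> X"
    moreover obtain i where "i \<in> {1..N}" "x \<in> cell i" using cellE assms(1) calculation by blast
    moreover obtain j where "j \<in> {1..N}" "y \<in> cell j" using cellE assms(1) calculation by blast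
    ultimately show "f x = f y"
      using *[of i j x y] *[of j i y x] by (cases "i \<le> j") auto
  qed
qed

lemma dist_S_scale:
  "i \<in> {1..N} \<Longrightarrow> dist x y < e / r i \<Longrightarrow> dist (S i x) (S i y) < e"
  using sim[of i x y] r_pos[of i] by (simp add: field_simps)

text \<open>If \<open>f\<close> does not change below distance \<open>e\<close>, its composition
  with \<open>S i\<close> does not change below \<open>e / r i\<close>. So \<open>f\<close> is
  constant on every cell, and the junctions link the cells.\<close>

lemma connected_\<gamma>: "connected \<gamma>"
proof (rule connected_compactI[OF comp])
  fix e :: real and f :: "'a \<Rightarrow> bool"
  assume "0 < e" "\<And>x y. x \<in> \<gamma> \<Longrightarrow> y \<in> \<gamma> \<Longrightarrow> dist x y < e \<Longrightarrow> f x = f y"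
  then show "\<forall>x\<in>\<gamma>. \<forall>y\<in>\<gamma>. f x = f y"
  proof (induction e arbitrary: f rule: scale_induct)
    case (large s)
    then show ?case using dist_le_diam by fastforce
  next
    case (small s)
    show ?case
    proof (rule const_on_chain)
      fix i x y assume i: "i \<in> {1..N}" and xy: "x \<in> \<gamma> \<inter> cell i" "y \<in> \<gamma> \<inter> cell i"
      have "\<forall>x\<in>\<gamma>. \<forall>y\<in>\<gamma>. f (S i x) = f (S i y)"
        using small.prems cell_subset[OF i] dist_S_scale[OF i] by (intro small.IH[OF i]) blast
      then show "f x = f y" using xy by auto
    qed (use z_mem in auto)
  qed
qed

text \<open>This is hereditary unicoherence of the arc; it is proved by cutting at the junction points,
  so that no parametrization of \<open>\<gamma>\<close> by an interval is needed.\<close>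

lemma connected_Int:
  assumes "compact P" "connected P" "P \<subseteq> \<gamma>" "compact Q" "connected Q" "Q \<subseteq> \<gamma>"
  shows "connected (P \<inter> Q)"
proof (rule connected_compactI)
  show "compact (P \<inter> Q)" using assms compact_Int by blast
  fix e :: real and f :: "'a \<Rightarrow> bool"
  assume "0 < e" "\<And>x y. x \<in> P \<inter> Q \<Longrightarrow> y \<in> P \<inter> Q \<Longrightarrow> dist x y < e \<Longrightarrow> f x = f y"
  then show "\<forall>x\<in>P \<inter> Q. \<forall>y\<in>P \<inter> Q. f x = f y"
    using assms(2,3,5,6)
  proof (induction e arbitrary: f P Q rule: scale_induct)
    case (large s)
    have "dist x y < s" if "x \<in> P \<inter> Q" "y \<in> P \<inter> Q" for x y
      using that large.prems(3) dist_le_diam[of x y] large.hyps by (auto simp: subset_iff)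
    then show ?case using large.prems(1) by blast
  next
    case (small s)
    show ?case
    proof (rule const_on_chain)
      fix i x y assume i: "i \<in> {1..N}"
        and xy: "x \<in> (P \<inter> Q) \<inter> cell i" "y \<in> (P \<inter> Q) \<inter> cell i"
      \<comment> \<open>\<open>P\<close> and \<open>Q\<close> vary in the induction because on a
        cell they are replaced by rescaled pieces, which \<open>connected_Int_cell\<close> keeps
        connected.\<close>
      let ?P = "pull i ` (P \<inter> cell i)" and ?Q = "pull i ` (Q \<inter> cell i)"
      have S_mem: "S i x \<in> R" if "x \<in> pull i ` (R \<inter> cell i)" for x R
        using that S_pull by auto
      have "\<forall>x\<in>?P \<inter> ?Q. \<forall>y\<in>?P \<inter> ?Q. f (S i x) = f (S i y)"
      proof (rule small.IH[OF i])
        show "f (S i x) = f (S i y)" if "x \<in> ?P \<inter> ?Q" "y \<in> ?P \<inter> ?Q" "dist x y < s / r i" for x y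
          using small.prems(1)[of "S i x" "S i y"] dist_S_scale[OF i that(3)] that S_mem by blast
        show "connected ?P" "connected ?Q"
          using connected_Int_cell[OF _ _ i] small.prems continuous_pull[OF i]
          by (auto intro!: connected_continuous_image)
        show "?P \<subseteq> \<gamma>" "?Q \<subseteq> \<gamma>" using pull_mem by auto
      qed
      moreover have "pull i x \<in> ?P \<inter> ?Q" "pull i y \<in> ?P \<inter> ?Q" using xy by auto
      ultimately have "f (S i (pull i x)) = f (S i (pull i y))" by blast
      then show "f x = f y" using S_pull xy by auto
    next
      show "P \<inter> Q \<subseteq> \<gamma>" using small.prems(3) by blast
    next
      fix i j k x y
      assume "x \<in> (P \<inter> Q) \<inter> cell i" "y \<in> (P \<inter> Q) \<inter> cell j"
        and ijk: "1 \<le> i" "i \<le> k" "k < j" "j \<le> N"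
      then have xy: "x \<in> P" "x \<in> Q" "x \<in> cell i" "y \<in> P" "y \<in> Q" "y \<in> cell j" by auto
      show "z k \<in> P \<inter> Q"
        using z_mem_connected[OF small.prems(2,3) xy(1,3,4,6) ijk]
          z_mem_connected[OF small.prems(4,5) xy(2,3,5,6) ijk] by simp
    qed
  qed
qed

lemma connected_cell: "i \<in> {1..N} \<Longrightarrow> connected (cell i)"
  using connected_\<gamma> continuous_S connected_continuous_image by blast

section \<open>Rescaling at the ends of \<gamma> and of its cells\<close>

text \<open>Otherwise \<open>j = 2\<close> and \<open>a = z 1\<close>, that is
  \<open>S 1 a = S 1 b\<close>, against \<open>a \<noteq> b\<close>.\<close>

lemma a_notin_cell: "\<lbrakk>j \<in> {1..N}; j \<noteq> 1\<rbrakk> \<Longrightarrow> a \<notin> cell j"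
proof
  assume j: "j \<in> {1..N}" "j \<noteq> 1" "a \<in> cell j"
  have one: "1 \<in> {1..N}" "1 \<in> {1..N-1}" using N2 by auto
  have a1: "a \<in> cell 1" using a_mem fix_a by (metis imageI)
  then have "j = Suc 1"
    using cells_meet_adjacent[of 1 j] j one by auto
  then have "a = z 1" using adjacent_z[OF one(2)] a1 j by blast
  then have "S 1 a = S 1 b" using fix_a unfolding z_def by simp
  then show False using inj_S[OF one(1), of UNIV] a_ne_b by (simp add: inj_eq)
qed

lemma b_notin_cell: "\<lbrakk>j \<in> {1..N}; j \<noteq> N\<rbrakk> \<Longrightarrow> b \<notin> cell j"
proof
  assume j: "j \<in> {1..N}" "j \<noteq> N" "b \<in> cell j"
  have N: "N \<in> {1..N}" using N2 by auto
  have bN: "b \<in> cell N" using b_mem fix_b by (metis imageI)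
  then have j': "N = Suc j" "j \<in> {1..N-1}"
    using cells_meet_adjacent[of j N] j N by auto
  then have "b = z j" using adjacent_z[OF j'(2)] bN j by blast
  then have "S N a = S N b" using fix_b z_Suc[OF j'(2)] j'(1) by simp
  then show False using inj_S[OF N, of UNIV] a_ne_b by (simp add: inj_eq)
qed

text \<open>Near \<open>c\<close> all of \<gamma> lies in the single cell \<open>m\<close>, so
  powers of \<open>S m\<close> reproduce it at all small scales. \<open>f\<close> is the power with
  ratio comparable to \<open>s\<close>; for the larger \<open>s\<close>, up to \<open>M\<close>, it
  is the identity.\<close>

lemma end_zoom:
  assumes m: "m \<in> {1..N}" "S m c = c" and others: "\<And>j. \<lbrakk>j \<in> {1..N}; j \<noteq> m\<rbrakk> \<Longrightarrow> c \<notin> cell j"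
    and "0 < M"
  obtains K where "1 \<le> K"
    "\<And>s. \<lbrakk>0 < s; s \<le> M\<rbrakk> \<Longrightarrow> \<exists>f l. f ` \<gamma> \<subseteq> \<gamma> \<and> f c = c \<and> \<gamma> \<inter> cball c s \<subseteq> f ` \<gamma> \<and>
        s / K \<le> l \<and> l \<le> K * s \<and> (\<forall>x\<in>\<gamma>. \<forall>y\<in>\<gamma>. dist (f x) (f y) = l * dist x y)"
proof -
  define q where "q = r m"
  have q: "0 < q" "q < 1" using r_pos r_less m unfolding q_def by auto
  define X where "X = (\<Union>j\<in>{1..N}-{m}. cell j)"
  have clX: "closed X"
    unfolding X_def by (intro closed_UN) (auto intro!: compact_imp_closed compact_cell)
  have "c \<notin> X" using others unfolding X_def by auto
  then obtain \<eta> where \<eta>: "0 < \<eta>" "\<And>x. x \<in> X \<Longrightarrow> \<eta> \<le> dist c x"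
    using separate_point_closed[OF clX] by metis
  have near: "x \<in> cell m" if x: "x \<in> \<gamma>" "dist c x < \<eta>" for x
  proof -
    have "x \<notin> X" using \<eta>(2)[of x] x(2) by auto
    obtain j where j: "j \<in> {1..N}" "x \<in> cell j" using x(1) cellE by blast
    then have "j = m" using \<open>x \<notin> X\<close> unfolding X_def by auto
    then show ?thesis using j by simp
  qed
  have T\<gamma>: "(S m ^^ k) ` \<gamma> \<subseteq> \<gamma>" for k
    using cell_subset[OF m(1)] by (induction k) auto
  have Tc: "(S m ^^ k) c = c" for k using m(2) by (induction k) auto
  have Tdist: "dist ((S m ^^ k) x) ((S m ^^ k) y) = q ^ k * dist x y" for k x y
    using sim[OF m(1)] by (induction k) (auto simp: q_def)
  have Tnear: "x \<in> (S m ^^ k) ` \<gamma>" if "x \<in> \<gamma>" "dist c x < \<eta> * q ^ k" for k x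
    using that
  proof (induction k arbitrary: x)
    case (Suc k)
    have "\<eta> * q ^ Suc k \<le> \<eta> * 1"
      using q \<eta> by (intro mult_left_mono power_le_one) auto
    then have "x \<in> cell m" using Suc.prems by (intro near) auto
    then obtain y where y: "y \<in> \<gamma>" "x = S m y" by blast
    have "q * dist c y < \<eta> * q ^ Suc k"
      using Suc.prems(2) sim[OF m(1), of c y] m(2) y(2) unfolding q_def by simp
    then have "dist c y < \<eta> * q ^ k" using q by (simp add: mult.left_commute)
    then have "y \<in> (S m ^^ k) ` \<gamma>" using Suc.IH y(1) by blast
    then show ?case using y(2) by auto
  qed auto
  \<comment> \<open>The identity, used for \<open>\<eta> \<le> s\<close>, needs \<open>M\<close> and
    \<open>1/\<eta>\<close>. For smaller \<open>s\<close> the ratio \<open>q ^ h\<close> lies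
    between \<open>s / \<eta>\<close> and \<open>s / (\<eta> * q)\<close>.\<close>
  define K where "K = max (max 1 M) (max (max \<eta> (1/\<eta>)) (1/(\<eta>*q)))"
  have K: "1 \<le> K" "M \<le> K" "\<eta> \<le> K" "1/\<eta> \<le> K" "1/(\<eta>*q) \<le> K" unfolding K_def by auto
  show ?thesis
  proof (rule that[OF K(1)])
    fix s assume s: "0 < s" "s \<le> M"
    have "\<exists>k. \<gamma> \<inter> cball c s \<subseteq> (S m ^^ k) ` \<gamma> \<and> s / K \<le> q ^ k \<and> q ^ k \<le> K * s"
    proof (cases "\<eta> \<le> s")
      case True
      have "s / K \<le> 1" using s K by simp
      moreover have "1 \<le> K * s"
      proof -
        have "1 \<le> (1/\<eta>) * s" using True \<eta>(1) by simp
        also have "\<dots> \<le> K * s" using K s by (intro mult_right_mono) auto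
        finally show ?thesis .
      qed
      ultimately show ?thesis by (intro exI[of _ 0]) auto
    next
      case False
      obtain n where n: "q ^ n < s / \<eta>"
        using real_arch_pow_inv[of "s / \<eta>" q] q \<eta> s by auto
      \<comment> \<open>The exponent used is the predecessor \<open>h\<close> of \<open>k\<close>,
        the last with \<open>s < \<eta> * q ^ h\<close>: \<open>Tnear\<close> needs this strict
        inequality, and \<open>\<eta> * q ^ k \<le> s\<close> bounds the ratio from above.\<close>
      define k where "k = (LEAST n. \<eta> * q ^ n \<le> s)"
      have k: "\<eta> * q ^ k \<le> s"
        unfolding k_def
        by (rule LeastI[of "\<lambda>n. \<eta> * q ^ n \<le> s" n]) (use n \<eta> in \<open>simp add: field_simps\<close>)
      have "k \<noteq> 0" using k False by (intro notI) auto
      then obtain h where h: "k = Suc h" using not0_implies_Suc by blast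
      have h': "s < \<eta> * q ^ h"
        using not_less_Least[of h "\<lambda>n. \<eta> * q ^ n \<le> s"] h unfolding k_def by simp
      have "s / K \<le> q ^ h"
      proof -
        have "s / \<eta> \<le> q ^ h" using h' \<eta> by (simp add: field_simps)
        moreover have "s / K \<le> s / \<eta>" using K s \<eta> by (intro divide_left_mono) auto
        ultimately show ?thesis by simp
      qed
      moreover have "q ^ h \<le> K * s"
      proof -
        have "q ^ h \<le> (1/(\<eta>*q)) * s" using k h q \<eta> by (simp add: field_simps)
        also have "\<dots> \<le> K * s" using K s by (intro mult_right_mono) auto
        finally show ?thesis .
      qed
      moreover have "\<gamma> \<inter> cball c s \<subseteq> (S m ^^ h) ` \<gamma>"
        using Tnear[of _ h] h' by auto
      ultimately show ?thesis by blast
    qed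
    then obtain k where "\<gamma> \<inter> cball c s \<subseteq> (S m ^^ k) ` \<gamma>" "s / K \<le> q ^ k" "q ^ k \<le> K * s"
      by blast
    then show "\<exists>f l. f ` \<gamma> \<subseteq> \<gamma> \<and> f c = c \<and> \<gamma> \<inter> cball c s \<subseteq> f ` \<gamma> \<and>
        s / K \<le> l \<and> l \<le> K * s \<and> (\<forall>x\<in>\<gamma>. \<forall>y\<in>\<gamma>. dist (f x) (f y) = l * dist x y)"
      using T\<gamma>[of k] Tc[of k] Tdist[of k]
      by (intro exI[of _ "S m ^^ k"] exI[of _ "q ^ k"]) auto
  qed
qed

text \<open>The zoom at an end of \<gamma>, conjugated by \<open>S i\<close>. With
  \<open>c = b\<close> in cell \<open>i\<close> and \<open>c = a\<close> in cell
  \<open>Suc i\<close> it serves both sides of \<open>z i\<close>. The change of scale by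
  \<open>r i\<close> costs a factor \<open>1 / \<mu>\<close>, uniform in \<open>i\<close>.\<close>

lemma cell_zoom:
  assumes "0 < M"
  obtains K where "1 \<le> K"
    "\<And>i c s. \<lbrakk>i \<in> {1..N}; c \<in> {a, b}; 0 < s; s \<le> M\<rbrakk> \<Longrightarrow>
      \<exists>g l. g ` cell i \<subseteq> cell i \<and> g (S i c) = S i c \<and> cell i \<inter> cball (S i c) s \<subseteq> g ` cell i \<and>
        s / K \<le> l \<and> l \<le> K * s \<and> (\<forall>x\<in>cell i. \<forall>y\<in>cell i. dist (g x) (g y) = l * dist x y)"
proof -
  let ?P = "\<lambda>K c s. \<exists>f l. f ` \<gamma> \<subseteq> \<gamma> \<and> f c = c \<and> \<gamma> \<inter> cball c s \<subseteq> f ` \<gamma> \<and>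
        s / K \<le> l \<and> l \<le> K * s \<and> (\<forall>x\<in>\<gamma>. \<forall>y\<in>\<gamma>. dist (f x) (f y) = l * dist x y)"
  \<comment> \<open>A radius \<open>s\<close> in a cell becomes \<open>s / r i\<close> in \<gamma>,
    hence the larger range.\<close>
  have M: "0 < M / \<mu>" using assms \<mu> by simp
  obtain K1 where K1: "1 \<le> K1" "\<And>s. \<lbrakk>0 < s; s \<le> M / \<mu>\<rbrakk> \<Longrightarrow> ?P K1 a s"
    using end_zoom[of 1 a, OF _ fix_a a_notin_cell M] N2 by auto
  obtain K2 where K2: "1 \<le> K2" "\<And>s. \<lbrakk>0 < s; s \<le> M / \<mu>\<rbrakk> \<Longrightarrow> ?P K2 b s"
    using end_zoom[of N b, OF _ fix_b b_notin_cell M] N2 by auto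
  define K where "K = max K1 K2"
  have K: "1 \<le> K" unfolding K_def using K1 by auto
  have mono: "?P K c s" if P: "?P K' c s" and "0 < s" "1 \<le> K'" "K' \<le> K" for K' c s
  proof -
    have "s / K \<le> s / K'" "K' * s \<le> K * s"
      using that by (auto intro!: divide_left_mono mult_right_mono)
    then show ?thesis using P by (meson order_trans)
  qed
  have zoom: "?P K c s" if "c \<in> {a, b}" "0 < s" "s \<le> M / \<mu>" for c s
  proof (cases "c = a")
    case True
    then show ?thesis using mono[OF K1(2)] K1(1) that unfolding K_def by simp
  next
    case False
    then have "c = b" using that by simp
    then show ?thesis using mono[OF K2(2)] K2(1) that unfolding K_def by simp
  qed
  have K\<mu>: "K \<le> K / \<mu>" using \<mu> K by (simp add: field_simps mult_left_le)
  show ?thesis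
  proof (rule that)
    show "1 \<le> K / \<mu>" using K K\<mu> by linarith
    fix i c s assume i: "i \<in> {1..N}" and c: "c \<in> {a, b}" and s: "0 < s" "s \<le> M"
    have ri: "0 < r i" "r i < 1" "\<mu> \<le> r i" using r_pos r_less \<mu> i by auto
    have "s / r i \<le> M / \<mu>" using s ri \<mu> by (intro frac_le) auto
    then obtain f l where f: "f ` \<gamma> \<subseteq> \<gamma>" "f c = c" "\<gamma> \<inter> cball c (s / r i) \<subseteq> f ` \<gamma>"
      and l: "s / r i / K \<le> l" "l \<le> K * (s / r i)"
      and fd: "\<forall>x\<in>\<gamma>. \<forall>y\<in>\<gamma>. dist (f x) (f y) = l * dist x y"
      using zoom[OF c, of "s / r i"] s ri by auto
    have c\<gamma>: "c \<in> \<gamma>" using c a_mem b_mem by auto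
    define g where "g = S i \<circ> f \<circ> pull i"
    have gS: "g (S i x) = S i (f x)" if "x \<in> \<gamma>" for x
      using pull_S[OF i that] unfolding g_def by simp
    have "s / (K / \<mu>) \<le> l"
    proof -
      have "s / (K / \<mu>) = s * \<mu> / K" by simp
      also have "\<dots> \<le> s / r i / K"
      proof (intro divide_right_mono)
        have "s * \<mu> \<le> s * 1" using s \<mu> by (intro mult_left_mono) auto
        also have "\<dots> \<le> s / r i" using s ri by (simp add: field_simps mult_left_le)
        finally show "s * \<mu> \<le> s / r i" .
      qed (use K in auto)
      finally show ?thesis using l by simp
    qed
    moreover have "l \<le> K / \<mu> * s"
    proof -
      have "K * (s / r i) = (K * s) / r i" by simp
      also have "\<dots> \<le> (K * s) / \<mu>" using K s ri \<mu> by (intro divide_left_mono) auto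
      finally show ?thesis using l by simp
    qed
    moreover have "g ` cell i \<subseteq> cell i" using gS f(1) by auto
    moreover have "g (S i c) = S i c" using gS[OF c\<gamma>] f(2) by simp
    moreover have "cell i \<inter> cball (S i c) s \<subseteq> g ` cell i"
    proof
      fix x assume "x \<in> cell i \<inter> cball (S i c) s"
      then obtain y where y: "y \<in> \<gamma>" "x = S i y" "dist (S i c) (S i y) \<le> s" by auto
      then have "dist c y \<le> s / r i" using sim[OF i] ri by (simp add: field_simps)
      then obtain w where "w \<in> \<gamma>" "y = f w" using f(3) y(1) by auto
      then show "x \<in> g ` cell i" using gS y(2) by (metis imageI)
    qed
    moreover have "\<forall>x\<in>cell i. \<forall>y\<in>cell i. dist (g x) (g y) = l * dist x y"
      using gS fd sim[OF i] by auto
    ultimately show "\<exists>g l. g ` cell i \<subseteq> cell i \<and> g (S i c) = S i c \<and>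
        cell i \<inter> cball (S i c) s \<subseteq> g ` cell i \<and> s / (K / \<mu>) \<le> l \<and> l \<le> K / \<mu> * s \<and>
        (\<forall>x\<in>cell i. \<forall>y\<in>cell i. dist (g x) (g y) = l * dist x y)"
      by blast
  qed
qed

text \<open>Zoomed to the scale \<open>s = dist p (S i c)\<close>, the cell still contains both
  points and has size at most \<open>K * s * diam\<close>. Turning relative to an end of a cell is
  thus bounded even without the junction estimate.\<close>

lemma end_continuum:
  obtains K where "1 \<le> K"
    "\<And>i c p. \<lbrakk>i \<in> {1..N}; c \<in> {a, b}; p \<in> cell i\<rbrakk> \<Longrightarrow>
      \<exists>E. compact E \<and> connected E \<and> E \<subseteq> cell i \<and> p \<in> E \<and> S i c \<in> E \<and>
        (\<forall>x\<in>E. \<forall>y\<in>E. dist x y \<le> K * dist p (S i c))"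
proof -
  obtain K where K: "1 \<le> K"
    "\<And>i c s. \<lbrakk>i \<in> {1..N}; c \<in> {a, b}; 0 < s; s \<le> diam\<rbrakk> \<Longrightarrow>
      \<exists>g l. g ` cell i \<subseteq> cell i \<and> g (S i c) = S i c \<and> cell i \<inter> cball (S i c) s \<subseteq> g ` cell i \<and>
        s / K \<le> l \<and> l \<le> K * s \<and> (\<forall>x\<in>cell i. \<forall>y\<in>cell i. dist (g x) (g y) = l * dist x y)"
    using cell_zoom[OF diam_pos] by blast
  show ?thesis
  proof (rule that)
    show "1 \<le> max 1 (K * diam)" by simp
    fix i c p assume i: "i \<in> {1..N}" and c: "c \<in> {a, b}" and p: "p \<in> cell i"
    have Sc: "S i c \<in> cell i" using c a_mem b_mem by auto
    show "\<exists>E. compact E \<and> connected E \<and> E \<subseteq> cell i \<and> p \<in> E \<and> S i c \<in> E \<and>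
        (\<forall>x\<in>E. \<forall>y\<in>E. dist x y \<le> max 1 (K * diam) * dist p (S i c))"
    proof (cases "p = S i c")
      case True
      then show ?thesis using p by (intro exI[of _ "{p}"]) auto
    next
      case False
      define s where "s = dist p (S i c)"
      have s: "0 < s" "s \<le> diam"
        using False dist_le_diam p Sc cell_subset[OF i] unfolding s_def by auto
      obtain g l where g: "g ` cell i \<subseteq> cell i" "g (S i c) = S i c"
          "cell i \<inter> cball (S i c) s \<subseteq> g ` cell i"
        and l: "s / K \<le> l" "l \<le> K * s"
        and gd: "\<forall>x\<in>cell i. \<forall>y\<in>cell i. dist (g x) (g y) = l * dist x y"
        using K(2)[OF i c s] by blast
      have l0: "0 < l" using l(1) s K(1) less_le_trans[OF divide_pos_pos[of s K]] by simp
      have cont: "continuous_on (cell i) g"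
        using gd l0 by (intro lipschitz_on_continuous_on[of l] lipschitz_onI) auto
      have "dist x y \<le> max 1 (K * diam) * s" if xy: "x \<in> g ` cell i" "y \<in> g ` cell i" for x y
      proof -
        obtain u v where uv: "u \<in> cell i" "v \<in> cell i" "x = g u" "y = g v" using xy by blast
        then have "dist x y = l * dist u v" using gd by blast
        also have "\<dots> \<le> (K * s) * diam"
          using l l0 uv cell_subset[OF i] by (intro mult_mono dist_le_diam) auto
        also have "\<dots> = (K * diam) * s" by simp
        also have "\<dots> \<le> max 1 (K * diam) * s" using s by (intro mult_right_mono) auto
        finally show ?thesis .
      qed
      moreover have "compact (g ` cell i)" "connected (g ` cell i)"
        using cont compact_cell[OF i] connected_cell[OF i]
        by (auto intro: compact_continuous_image connected_continuous_image)
      moreover have "p \<in> g ` cell i" using g(3) p unfolding s_def by (auto simp: dist_commute)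
      moreover have "S i c \<in> g ` cell i" using g(2) Sc by (metis imageI)
      ultimately show ?thesis using g(1) unfolding s_def by blast
    qed
  qed
qed

section \<open>Gaps between cells and small continua\<close>

lemma cell_gap:
  obtains \<delta> where "0 < \<delta>"
    "\<And>i j x y. \<lbrakk>i \<in> {1..N}; j \<in> {1..N}; Suc i < j; x \<in> cell i; y \<in> cell j\<rbrakk> \<Longrightarrow> \<delta> \<le> dist x y"
proof -
  have "finite (cell ` {1..N})" "\<And>A. A \<in> cell ` {1..N} \<Longrightarrow> compact A"
    using compact_cell by auto
  then obtain d where d: "d > 0"
    "\<And>A B x y. \<lbrakk>A \<in> cell ` {1..N}; B \<in> cell ` {1..N}; A \<inter> B = {}; x \<in> A; y \<in> B\<rbrakk> \<Longrightarrow> d \<le> dist x y"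
    using finite_compact_gap by blast
  show ?thesis
    using that[OF d(1)] d(2)[OF _ _ disjoint_cells] by blast
qed

lemma fine_cover:
  assumes "0 < e"
  shows "\<exists>F. finite F \<and> \<Union>F = \<gamma> \<and>
    (\<forall>A\<in>F. compact A \<and> connected A \<and> (\<forall>x\<in>A. \<forall>y\<in>A. dist x y < e))"
  using assms
proof (induction e rule: scale_induct)
  case (large s)
  have "dist x y < s" if "x \<in> \<gamma>" "y \<in> \<gamma>" for x y
    using dist_le_diam[OF that] large by simp
  then show ?case using comp connected_\<gamma> by (intro exI[of _ "{\<gamma>}"]) auto
next
  case (small s)
  then obtain F where F: "\<And>i. i \<in> {1..N} \<Longrightarrow> finite (F i) \<and> \<Union>(F i) = \<gamma> \<and>
      (\<forall>A\<in>F i. compact A \<and> connected A \<and> (\<forall>x\<in>A. \<forall>y\<in>A. dist x y < s / r i))"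
    by metis
  let ?G = "\<Union>i\<in>{1..N}. (\<lambda>A. S i ` A) ` F i"
  have "finite ?G" using F by auto
  moreover have "\<Union>?G = \<gamma>"
  proof -
    have "\<Union>?G = (\<Union>i\<in>{1..N}. S i ` \<Union>(F i))" by blast
    also have "\<dots> = \<gamma>" using F invariant by simp
    finally show ?thesis .
  qed
  moreover have "compact A \<and> connected A \<and> (\<forall>x\<in>A. \<forall>y\<in>A. dist x y < s)" if A: "A \<in> ?G" for A
  proof -
    obtain i B where B: "i \<in> {1..N}" "B \<in> F i" "A = S i ` B" using A by blast
    then have "compact B" "connected B" "\<forall>x\<in>B. \<forall>y\<in>B. dist x y < s / r i" using F by auto
    then show ?thesis
      using B dist_S_scale continuous_S[OF B(1)]
      by (auto intro!: compact_continuous_image connected_continuous_image)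
  qed
  ultimately show ?case by blast
qed

text \<open>Uniform local connectedness. In a fine finite cover by continua, disjoint members have a
  gap; closer points lie in two members that meet, and the union of these is the continuum.\<close>

lemma small_continuum:
  assumes "0 < e"
  obtains \<delta> where "0 < \<delta>"
    "\<And>x y. \<lbrakk>x \<in> \<gamma>; y \<in> \<gamma>; dist x y < \<delta>\<rbrakk> \<Longrightarrow>
      \<exists>G. compact G \<and> connected G \<and> G \<subseteq> \<gamma> \<and> x \<in> G \<and> y \<in> G \<and> (\<forall>u\<in>G. \<forall>v\<in>G. dist u v < e)"
proof -
  obtain F where F: "finite F" "\<Union>F = \<gamma>"
    and FA: "\<And>A. A \<in> F \<Longrightarrow> compact A \<and> connected A \<and> (\<forall>x\<in>A. \<forall>y\<in>A. dist x y < e / 2)"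
    using fine_cover[of "e/2"] assms by (metis half_gt_zero)
  obtain d where d: "d > 0"
    "\<And>A B x y. \<lbrakk>A \<in> F; B \<in> F; A \<inter> B = {}; x \<in> A; y \<in> B\<rbrakk> \<Longrightarrow> d \<le> dist x y"
    using finite_compact_gap[OF F(1)] FA by blast
  show ?thesis
  proof (rule that[OF d(1)])
    fix x y assume xy: "x \<in> \<gamma>" "y \<in> \<gamma>" "dist x y < d"
    obtain A B where AB: "A \<in> F" "B \<in> F" "x \<in> A" "y \<in> B" using xy F(2) by blast
    then have "A \<inter> B \<noteq> {}" using d(2)[of A B x y] xy(3) by auto
    then obtain w where w: "w \<in> A" "w \<in> B" by blast
    have "dist u w < e / 2" if "u \<in> A \<union> B" for u using FA AB w that by blast
    then have "dist u v < e" if "u \<in> A \<union> B" "v \<in> A \<union> B" for u v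
      using that dist_triangle_half_r[of w u e v] by (metis dist_commute)
    moreover have "connected (A \<union> B)" "compact (A \<union> B)"
      using FA AB w by (auto intro!: connected_Un compact_Un)
    ultimately show "\<exists>G. compact G \<and> connected G \<and> G \<subseteq> \<gamma> \<and> x \<in> G \<and> y \<in> G \<and>
        (\<forall>u\<in>G. \<forall>v\<in>G. dist u v < e)"
      using AB F(2) by (intro exI[of _ "A \<union> B"]) auto
  qed
qed

section \<open>Bounded turning and the junction estimate\<close>

text \<open>Bounding the distance of \<open>p\<close> alone is enough: the triangle inequality
  bounds that of \<open>q\<close> with \<open>1 + C\<close>. So \<open>dist p q\<close> is
  comparable to the sum of the distances of \<open>p\<close> and \<open>q\<close> to
  \<open>z i\<close>.\<close>

definition junction_turning :: "real \<Rightarrow> bool" where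
  "junction_turning C \<longleftrightarrow>
     (\<forall>i\<in>{1..N-1}. \<forall>p\<in>cell i. \<forall>q\<in>cell (Suc i). dist p (z i) \<le> C * dist p q)"

lemma junction_turningD:
  assumes "junction_turning C" "i \<in> {1..N-1}" "p \<in> cell i" "q \<in> cell (Suc i)"
  shows "dist p (z i) \<le> C * dist p q" "dist q (z i) \<le> (1 + C) * dist p q"
proof -
  show *: "dist p (z i) \<le> C * dist p q" using assms unfolding junction_turning_def by blast
  show "dist q (z i) \<le> (1 + C) * dist p q"
    using * dist_triangle[of q "z i" p] by (simp add: dist_commute algebra_simps)
qed

text \<open>A continuum joining the two sides contains \<open>z i\<close>, so its diameter bounds
  \<open>dist p (z i)\<close>.\<close>

lemma bounded_turning_imp_junction_turning:
  assumes "bounded_turning \<gamma>"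
  shows "\<exists>C>0. junction_turning C"
proof -
  obtain C where C: "1 \<le> C" and E: "\<And>p q. \<lbrakk>p \<in> \<gamma>; q \<in> \<gamma>; p \<noteq> q\<rbrakk> \<Longrightarrow>
      \<exists>E. E \<subseteq> \<gamma> \<and> compact E \<and> connected E \<and> p \<in> E \<and> q \<in> E \<and> diameter E \<le> C * dist p q"
    using assms unfolding bounded_turning_def by blast
  have "dist p (z i) \<le> C * dist p q"
    if i: "i \<in> {1..N-1}" and p: "p \<in> cell i" and q: "q \<in> cell (Suc i)" for i p q
  proof (cases "p = q")
    case True
    then have "p = z i" using adjacent_z[OF i] p q by blast
    then show ?thesis using C by simp
  next
    case False
    have iN: "i \<in> {1..N}" "Suc i \<in> {1..N}" using i by auto
    have "p \<in> \<gamma>" "q \<in> \<gamma>" using p q cell_subset[OF iN(1)] cell_subset[OF iN(2)] by auto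
    then obtain E where E: "E \<subseteq> \<gamma>" "compact E" "connected E" "p \<in> E" "q \<in> E"
        "diameter E \<le> C * dist p q"
      using E[OF _ _ False] by blast
    have "z i \<in> E" using z_mem_connected[OF E(3,1,4) p E(5) q] iN by auto
    then have "dist p (z i) \<le> diameter E"
      using diameter_bounded_bound[OF compact_imp_bounded[OF E(2)]] E(4) by blast
    then show ?thesis using E(6) by simp
  qed
  then have "junction_turning C" unfolding junction_turning_def by blast
  then show ?thesis using C by (intro exI[of _ C]) auto
qed

text \<open>Across a gap, \<gamma> itself is a continuum of admissible size; in adjacent cells the
  end continua of \<open>p\<close> and \<open>q\<close> are joined at \<open>z i\<close>.\<close>

lemma junction_continuum:
  assumes "junction_turning C" "0 < C"
  obtains K where "1 \<le> K"
    "\<And>i j p q. \<lbrakk>i \<in> {1..N}; j \<in> {1..N}; i < j; p \<in> cell i; q \<in> cell j\<rbrakk> \<Longrightarrow>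
      \<exists>E. compact E \<and> connected E \<and> E \<subseteq> \<gamma> \<and> p \<in> E \<and> q \<in> E \<and>
        (\<forall>x\<in>E. \<forall>y\<in>E. dist x y \<le> K * dist p q)"
proof -
  obtain \<delta> where \<delta>: "0 < \<delta>"
    "\<And>i j x y. \<lbrakk>i \<in> {1..N}; j \<in> {1..N}; Suc i < j; x \<in> cell i; y \<in> cell j\<rbrakk> \<Longrightarrow> \<delta> \<le> dist x y"
    using cell_gap by blast
  obtain L where L: "1 \<le> L"
    "\<And>i c p. \<lbrakk>i \<in> {1..N}; c \<in> {a, b}; p \<in> cell i\<rbrakk> \<Longrightarrow>
      \<exists>E. compact E \<and> connected E \<and> E \<subseteq> cell i \<and> p \<in> E \<and> S i c \<in> E \<and>
        (\<forall>x\<in>E. \<forall>y\<in>E. dist x y \<le> L * dist p (S i c))"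
    using end_continuum by blast
  \<comment> \<open>\<open>diam / \<delta>\<close> serves non-adjacent cells; the last entry adds
    the sizes of the two end continua, measured in units of \<open>dist p q\<close>.\<close>
  define K where "K = max 1 (max (diam / \<delta>) (L * C + L * (1 + C)))"
  have K: "1 \<le> K" "diam / \<delta> \<le> K" "L * C + L * (1 + C) \<le> K" unfolding K_def by auto
  show ?thesis
  proof (rule that[OF K(1)])
    fix i j p q assume ij: "i \<in> {1..N}" "j \<in> {1..N}" "i < j" and p: "p \<in> cell i" and q: "q \<in> cell j"
    show "\<exists>E. compact E \<and> connected E \<and> E \<subseteq> \<gamma> \<and> p \<in> E \<and> q \<in> E \<and>
        (\<forall>x\<in>E. \<forall>y\<in>E. dist x y \<le> K * dist p q)"
    proof (cases "j = Suc i")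
      case False
      then have "\<delta> \<le> dist p q" using \<delta>(2)[OF ij(1,2) _ p q] ij(3) by simp
      have "dist x y \<le> K * dist p q" if "x \<in> \<gamma>" "y \<in> \<gamma>" for x y
      proof -
        have "dist x y \<le> (diam / \<delta>) * \<delta>" using dist_le_diam[OF that] \<delta>(1) by simp
        also have "\<dots> \<le> K * dist p q"
          using K \<delta>(1) \<open>\<delta> \<le> dist p q\<close> by (intro mult_mono) auto
        finally show ?thesis .
      qed
      moreover have "p \<in> \<gamma>" "q \<in> \<gamma>" using p q cell_subset[OF ij(1)] cell_subset[OF ij(2)] by auto
      ultimately show ?thesis using comp connected_\<gamma> by (intro exI[of _ \<gamma>]) auto
    next
      case True
      then have i: "i \<in> {1..N-1}" and q': "q \<in> cell (Suc i)" using ij q by auto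
      obtain E1 where E1: "compact E1" "connected E1" "E1 \<subseteq> cell i" "p \<in> E1" "z i \<in> E1"
          "\<forall>x\<in>E1. \<forall>y\<in>E1. dist x y \<le> L * dist p (z i)"
        using L(2)[OF ij(1) _ p, of b] unfolding z_def by auto
      obtain E2 where E2: "compact E2" "connected E2" "E2 \<subseteq> cell j" "q \<in> E2" "z i \<in> E2"
          "\<forall>x\<in>E2. \<forall>y\<in>E2. dist x y \<le> L * dist q (z i)"
        using L(2)[OF ij(2) _ q, of a] z_Suc[OF i] True by auto
      have d: "L * dist p (z i) \<le> (L * C) * dist p q"
        "L * dist q (z i) \<le> (L * (1 + C)) * dist p q"
        using junction_turningD[OF assms(1) i p q'] L(1) by (simp_all add: mult.assoc)
      have "dist x (z i) + dist (z i) y \<le> K * dist p q" if "x \<in> E1" "y \<in> E2" for x y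
      proof -
        have "dist x (z i) + dist (z i) y \<le> (L * C) * dist p q + (L * (1 + C)) * dist p q"
          using E1(5,6) E2(5,6) d that by (meson add_mono order_trans)
        also have "\<dots> = (L * C + L * (1 + C)) * dist p q" by (simp add: algebra_simps)
        also have "\<dots> \<le> K * dist p q" using K by (intro mult_right_mono) auto
        finally show ?thesis .
      qed
      then have 12: "dist x y \<le> K * dist p q" if "x \<in> E1" "y \<in> E2" for x y
        using that dist_triangle[of x y "z i"] by (meson order_trans)
      have "(L * C) * dist p q \<le> K * dist p q" "(L * (1 + C)) * dist p q \<le> K * dist p q"
        using K L(1) assms(2) by (auto intro!: mult_right_mono intro: order_trans[OF _ K(3)])
      then have 11: "dist x y \<le> K * dist p q" if "x \<in> E1" "y \<in> E1 \<or> y \<in> E2 \<and> x \<in> E2" for x y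
        using that E1(6) E2(6) d by (meson order_trans)
      have 22: "dist x y \<le> K * dist p q" if "x \<in> E2" "y \<in> E2" for x y
        using that E2(6) d \<open>(L * (1 + C)) * dist p q \<le> K * dist p q\<close> by (meson order_trans)
      have "dist x y \<le> K * dist p q" if "x \<in> E1 \<union> E2" "y \<in> E1 \<union> E2" for x y
        using that 11[of x y] 12[of x y] 12[of y x] 22[of x y] by (auto simp: dist_commute)
      moreover have "compact (E1 \<union> E2)" "connected (E1 \<union> E2)" "E1 \<union> E2 \<subseteq> \<gamma>"
        using E1 E2 cell_subset[OF ij(1)] cell_subset[OF ij(2)]
        by (auto intro!: compact_Un connected_Un)
      ultimately show ?thesis using E1(4) E2(4) by (intro exI[of _ "E1 \<union> E2"]) auto
    qed
  qed
qed

text \<open>The size of \<open>E\<close> relative to \<open>dist p q\<close> is invariant under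
  \<open>S i\<close>, so the \<open>K\<close> of pairs in different cells does for all
  pairs.\<close>

lemma junction_turning_imp_bounded_turning:
  assumes "junction_turning C" "0 < C"
  shows "bounded_turning \<gamma>"
proof -
  obtain K where K: "1 \<le> K"
    "\<And>i j p q. \<lbrakk>i \<in> {1..N}; j \<in> {1..N}; i < j; p \<in> cell i; q \<in> cell j\<rbrakk> \<Longrightarrow>
      \<exists>E. compact E \<and> connected E \<and> E \<subseteq> \<gamma> \<and> p \<in> E \<and> q \<in> E \<and>
        (\<forall>x\<in>E. \<forall>y\<in>E. dist x y \<le> K * dist p q)"
    using junction_continuum[OF assms] by blast
  let ?Q = "\<lambda>p q. \<exists>E. compact E \<and> connected E \<and> E \<subseteq> \<gamma> \<and> p \<in> E \<and> q \<in> E \<and>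
        (\<forall>x\<in>E. \<forall>y\<in>E. dist x y \<le> K * dist p q)"
  have "?Q p q" if "0 < s" "s = dist p q" "p \<in> \<gamma>" "q \<in> \<gamma>" for s p q
    using that
  proof (induction s arbitrary: p q rule: scale_induct)
    case (large s)
    then show ?case using dist_le_diam[of p q] by simp
  next
    case (small s)
    obtain i where i: "i \<in> {1..N}" "p \<in> cell i" using small.prems cellE by blast
    obtain j where j: "j \<in> {1..N}" "q \<in> cell j" using small.prems cellE by blast
    consider "i < j" | "j < i" | "i = j" by linarith
    then show ?case
    proof cases
      case 1
      then show ?thesis using K(2) i j by blast
    next
      case 2
      then show ?thesis using K(2)[of j i q p] i j by (auto simp: dist_commute)
    next
      case 3
      then have q: "q \<in> cell i" using j by simp
      have "?Q (pull i p) (pull i q)"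
        using small.prems i q by (intro small.IH[OF i(1)]) (auto simp: dist_pull pull_mem)
      then obtain E where E: "compact E" "connected E" "E \<subseteq> \<gamma>" "pull i p \<in> E" "pull i q \<in> E"
          "\<forall>x\<in>E. \<forall>y\<in>E. dist x y \<le> K * (dist p q / r i)"
        using dist_pull[OF i(1,2) q] by auto
      have "dist (S i x) (S i y) \<le> K * dist p q" if "x \<in> E" "y \<in> E" for x y
      proof -
        have "dist x y \<le> K * (dist p q / r i)" using E(6) that by blast
        then show ?thesis using sim[OF i(1), of x y] r_pos[OF i(1)] by (simp add: field_simps)
      qed
      moreover have "compact (S i ` E)" "connected (S i ` E)"
        using E continuous_S[OF i(1)]
        by (auto intro: compact_continuous_image connected_continuous_image)
      moreover have "S i ` E \<subseteq> \<gamma>" using E(3) cell_subset[OF i(1)] by blast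
      moreover have "p \<in> S i ` E" "q \<in> S i ` E"
        using E(4,5) S_pull[OF i(2)] S_pull[OF q] by (metis imageI)+
      ultimately show ?thesis by (intro exI[of _ "S i ` E"]) auto
    qed
  qed
  then have Q: "?Q p q" if "p \<in> \<gamma>" "q \<in> \<gamma>" "p \<noteq> q" for p q
    using that by auto
  have "\<exists>E. E \<subseteq> \<gamma> \<and> compact E \<and> connected E \<and> p \<in> E \<and> q \<in> E \<and> diameter E \<le> K * dist p q"
    if pq: "p \<in> \<gamma>" "q \<in> \<gamma>" "p \<noteq> q" for p q
  proof -
    obtain E where E: "compact E" "connected E" "E \<subseteq> \<gamma>" "p \<in> E" "q \<in> E"
      "\<forall>x\<in>E. \<forall>y\<in>E. dist x y \<le> K * dist p q"
      using Q[OF pq] by blast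
    then have "diameter E \<le> K * dist p q"
      by (intro diameter_le) (auto simp: dist_norm)
    then show ?thesis using E by blast
  qed
  then show ?thesis unfolding bounded_turning_def using K(1) by blast
qed

section \<open>Condition (2)\<close>

text \<open>Pulled back to a scale above \<open>diam\<close>, the ball contains all of \<gamma>,
  where the identity serves as \<psi>; the maps \<open>S i\<close> carry it back.\<close>

lemma ball_contains_similar_copy:
  obtains C r1 where "0 < C" "0 < r1"
    "\<And>x s. \<lbrakk>x \<in> \<gamma>; 0 < s; s < r1\<rbrakk> \<Longrightarrow>
      \<exists>\<psi>. \<psi> ` \<gamma> \<subseteq> ball x s \<inter> \<gamma> \<and> (\<forall>u\<in>\<gamma>. \<forall>v\<in>\<gamma>. C * s * dist u v \<le> dist (\<psi> u) (\<psi> v))"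
proof -
  \<comment> \<open>A pull-back from \<open>s \<le> diam\<close> leads to at most
    \<open>diam / \<mu> < M\<close>, so the induction never leaves the range \<open>s < M\<close>;
    there \<open>s / M \<le> 1\<close> admits the identity.\<close>
  define M where "M = 2 * diam / \<mu>"
  let ?C = "1 / M"
  have M: "0 < M" using diam_pos \<mu> unfolding M_def by simp
  have "\<exists>\<psi>. \<psi> ` \<gamma> \<subseteq> ball x s \<inter> \<gamma> \<and> (\<forall>u\<in>\<gamma>. \<forall>v\<in>\<gamma>. ?C * s * dist u v \<le> dist (\<psi> u) (\<psi> v))"
    if "0 < s" "x \<in> \<gamma>" "s < M" for x s
    using that
  proof (induction s arbitrary: x rule: scale_induct)
    case (large s)
    have "?C * s \<le> 1" using large M by simp
    then have "?C * s * dist u v \<le> dist u v" for u v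
      using mult_right_mono[of "?C * s" 1 "dist u v"] by simp
    moreover have "\<gamma> \<subseteq> ball x s" using large dist_le_diam[of x] by fastforce
    ultimately show ?case by (intro exI[of _ id]) auto
  next
    case (small s)
    obtain i where i: "i \<in> {1..N}" "x \<in> cell i" using small.prems cellE by blast
    have ri: "0 < r i" "\<mu> \<le> r i" using r_pos \<mu> i by auto
    have "s / r i \<le> diam / \<mu>" using small.hyps ri \<mu> by (intro frac_le) auto
    also have "\<dots> < M" using diam_pos \<mu> unfolding M_def by (simp add: divide_strict_right_mono)
    finally have "s / r i < M" .
    then obtain \<psi> where \<psi>: "\<psi> ` \<gamma> \<subseteq> ball (pull i x) (s / r i) \<inter> \<gamma>"
        "\<forall>u\<in>\<gamma>. \<forall>v\<in>\<gamma>. ?C * (s / r i) * dist u v \<le> dist (\<psi> u) (\<psi> v)"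
      using small.IH[OF i(1), of "pull i x"] pull_mem[OF i(2)] by blast
    have "S i (\<psi> u) \<in> ball x s \<inter> \<gamma>" if "u \<in> \<gamma>" for u
    proof -
      have "dist (pull i x) (\<psi> u) < s / r i" "\<psi> u \<in> \<gamma>" using \<psi>(1) that by auto
      then show ?thesis
        using dist_S_scale[OF i(1)] S_pull[OF i(2)] cell_subset[OF i(1)] by fastforce
    qed
    moreover have "?C * s * dist u v \<le> dist (S i (\<psi> u)) (S i (\<psi> v))" if "u \<in> \<gamma>" "v \<in> \<gamma>" for u v
    proof -
      have "r i * (?C * (s / r i) * dist u v) \<le> r i * dist (\<psi> u) (\<psi> v)"
        using \<psi>(2) that ri by (intro mult_left_mono) auto
      then show ?thesis using sim[OF i(1)] ri by simp
    qed
    ultimately show ?case by (intro exI[of _ "S i \<circ> \<psi>"]) auto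
  qed
  then show ?thesis using that[of ?C M] M by auto
qed

section \<open>Condition (1) from the junction estimate\<close>

text \<open>The conclusion of condition (1) for any set \<open>W\<close> in place of
  \<open>U \<inter> \<gamma>\<close>, so that it can be asked of pulled-back sets.\<close>

definition blows_up :: "'a set \<Rightarrow> real \<Rightarrow> real \<Rightarrow> bool" where
  "blows_up W C1 C2 \<longleftrightarrow> (\<exists>\<phi>. \<phi> ` W \<subseteq> \<gamma> \<and> (\<forall>x\<in>W. \<forall>y\<in>W.
     C1 * dist x y / diameter W \<le> dist (\<phi> x) (\<phi> y) \<and>
     dist (\<phi> x) (\<phi> y) \<le> C2 * dist x y / diameter W))"

lemma diameter_pull:
  assumes i: "i \<in> {1..N}" and W: "W \<subseteq> cell i"
  shows "diameter (pull i ` W) = diameter W / r i"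
proof -
  have "bounded W" using W bounded_subset compact_imp_bounded compact_cell[OF i] by blast
  moreover have "dist (pull i x) (pull i y) = 1 / r i * dist x y" if "x \<in> W" "y \<in> W" for x y
    using dist_pull[OF i, of x y] W that by auto
  moreover have "0 < 1 / r i" using r_pos[OF i] by simp
  ultimately have "diameter (pull i ` W) = 1 / r i * diameter W"
    by (intro diameter_similar_image) auto
  then show ?thesis by simp
qed

text \<open>Distances and diameter both acquire the factor \<open>1 / r i\<close>, which cancels;
  the constants do not change.\<close>

lemma blows_up_pull:
  assumes i: "i \<in> {1..N}" and W: "W \<subseteq> cell i" and "blows_up (pull i ` W) C1 C2"
  shows "blows_up W C1 C2"
proof -
  have ri: "0 < r i" using r_pos i by auto
  have dp: "dist (pull i x) (pull i y) = dist x y / r i" if "x \<in> W" "y \<in> W" for x y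
    using dist_pull[OF i, of x y] W that by auto
  obtain \<phi> where \<phi>: "\<phi> ` pull i ` W \<subseteq> \<gamma>" "\<forall>x\<in>pull i ` W. \<forall>y\<in>pull i ` W.
      C1 * dist x y / diameter (pull i ` W) \<le> dist (\<phi> x) (\<phi> y) \<and>
      dist (\<phi> x) (\<phi> y) \<le> C2 * dist x y / diameter (pull i ` W)"
    using assms(3) unfolding blows_up_def by blast
  have "C1 * dist x y / diameter W \<le> dist (\<phi> (pull i x)) (\<phi> (pull i y)) \<and>
      dist (\<phi> (pull i x)) (\<phi> (pull i y)) \<le> C2 * dist x y / diameter W" if "x \<in> W" "y \<in> W" for x y
  proof -
    have "C1 * dist (pull i x) (pull i y) / diameter (pull i ` W) \<le> dist (\<phi> (pull i x)) (\<phi> (pull i y)) \<and>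
      dist (\<phi> (pull i x)) (\<phi> (pull i y)) \<le> C2 * dist (pull i x) (pull i y) / diameter (pull i ` W)"
      using \<phi>(2) that by blast
    then show ?thesis unfolding dp[OF that] diameter_pull[OF i W] using ri by simp
  qed
  then show ?thesis
    unfolding blows_up_def using \<phi>(1) by (intro exI[of _ "\<phi> \<circ> pull i"]) auto
qed

lemma inverse_zoom:
  assumes "g ` A \<subseteq> A" "w \<in> A" "g w = w" "A \<inter> cball w s \<subseteq> g ` A" "0 < l"
    and gd: "\<forall>x\<in>A. \<forall>y\<in>A. dist (g x) (g y) = l * dist x y"
  obtains h where "\<And>x. x \<in> A \<inter> cball w s \<Longrightarrow> h x \<in> A" "h w = w"
    "\<And>x y. \<lbrakk>x \<in> A \<inter> cball w s; y \<in> A \<inter> cball w s\<rbrakk> \<Longrightarrow> dist (h x) (h y) = dist x y / l"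
    "\<And>x. x \<in> A \<inter> cball w s \<Longrightarrow> dist (h x) w = dist x w / l"
proof -
  define h where "h = inv_into A g"
  have inj: "inj_on g A"
  proof (rule inj_onI)
    fix x y assume xy: "x \<in> A" "y \<in> A" "g x = g y"
    then have "l * dist x y = 0" using gd by (metis dist_self)
    then show "x = y" using assms(5) by simp
  qed
  have h: "h x \<in> A" "g (h x) = x" if "x \<in> A \<inter> cball w s" for x
  proof -
    have "x \<in> g ` A" using assms(4) that by blast
    then show "h x \<in> A" "g (h x) = x"
      unfolding h_def by (auto intro: inv_into_into f_inv_into_f)
  qed
  have hw: "h w = w" unfolding h_def using inv_into_f_f[OF inj assms(2)] assms(3) by simp
  have d: "dist (h x) (h y) = dist x y / l"
    if "x \<in> A \<inter> cball w s" "y \<in> A \<inter> cball w s" for x y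
  proof -
    have "dist (g (h x)) (g (h y)) = l * dist (h x) (h y)" using gd h that by blast
    then show ?thesis using h that assms(5) by (simp add: field_simps)
  qed
  have dw: "dist (h x) w = dist x w / l" if "x \<in> A \<inter> cball w s" for x
  proof -
    have "dist (g (h x)) (g w) = l * dist (h x) w" using gd h(1)[OF that] assms(2) by blast
    then show ?thesis using h(2)[OF that] assms(3,5) by (simp add: field_simps)
  qed
  show ?thesis using that[OF h(1) hw d dw] by blast
qed

text \<open>Each side of \<open>W\<close> is enlarged by the inverse of a zoom fixing
  \<open>z i\<close>, both at the same scale \<open>s\<close>. Within a side this is a similarity of
  the right size. Across the junction, distances are comparable to sums of distances to
  \<open>z i\<close>, before and after the enlargement, and these sums grow by the right
  factor.\<close>

lemma blows_up_across_junction: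
  assumes jt: "junction_turning C" and "0 < C"
  obtains C1 C2 where "0 < C1" "0 < C2"
    "\<And>i W p q. \<lbrakk>i \<in> {1..N-1}; W \<subseteq> cell i \<union> cell (Suc i); 0 < diameter W;
        p \<in> W \<inter> cell i; q \<in> W \<inter> cell (Suc i)\<rbrakk> \<Longrightarrow> blows_up W C1 C2"
proof -
  have "0 < (1 + C) * diam" using assms diam_pos by simp
  then obtain K where K: "1 \<le> K"
    "\<And>i c s. \<lbrakk>i \<in> {1..N}; c \<in> {a, b}; 0 < s; s \<le> (1 + C) * diam\<rbrakk> \<Longrightarrow>
      \<exists>g l. g ` cell i \<subseteq> cell i \<and> g (S i c) = S i c \<and> cell i \<inter> cball (S i c) s \<subseteq> g ` cell i \<and>
        s / K \<le> l \<and> l \<le> K * s \<and> (\<forall>x\<in>cell i. \<forall>y\<in>cell i. dist (g x) (g y) = l * dist x y)"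
    using cell_zoom by blast
  \<comment> \<open>\<open>K * (1 + C)\<close> bounds the ratios of the zooms in units of
    \<open>d\<close>, because \<open>s = (1 + C) * d\<close>; \<open>1 + 2 * C\<close> is the loss
    between a distance across the junction and the sum of distances to it.\<close>
  define H where "H = K * (1 + C) * (1 + 2 * C)"
  have H: "0 < H" "K * (1 + C) \<le> H" "K * (1 + 2 * C) \<le> H" "K \<le> H"
  proof -
    define u v where "u = K * C" and "v = K * C * C"
    have "0 < K" "0 < u" "0 < v" using K(1) assms(2) unfolding u_def v_def by auto
    moreover have "H = K + 3 * u + 2 * v" "K * (1 + C) = K + u" "K * (1 + 2 * C) = K + 2 * u"
      unfolding H_def u_def v_def by (simp_all add: algebra_simps)
    ultimately show "0 < H" "K * (1 + C) \<le> H" "K * (1 + 2 * C) \<le> H" "K \<le> H" by simp_all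
  qed
  show ?thesis
  proof (rule that)
    show "0 < 1 / H" "0 < H" using H by auto
    fix i W p q assume i: "i \<in> {1..N-1}" and W: "W \<subseteq> cell i \<union> cell (Suc i)"
      and d0: "0 < diameter W" and p: "p \<in> W \<inter> cell i" and q: "q \<in> W \<inter> cell (Suc i)"
    have iN: "i \<in> {1..N}" "Suc i \<in> {1..N}" using i by auto
    define d where "d = diameter W"
    \<comment> \<open>The radius of a ball around \<open>z i\<close> that contains \<open>W\<close>:
      the estimate puts \<open>p\<close> within \<open>C * d\<close>, and every point of
      \<open>W\<close> is within \<open>d\<close> of \<open>p\<close>.\<close>
    define s where "s = (1 + C) * d"
    have W\<gamma>: "W \<subseteq> \<gamma>" using W cell_subset[OF iN(1)] cell_subset[OF iN(2)] by blast
    have bW: "bounded W" using W\<gamma> bounded_subset compact_imp_bounded[OF comp] by blast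
    have Wd: "dist x y \<le> d" if "x \<in> W" "y \<in> W" for x y
      using diameter_bounded_bound[OF bW] that unfolding d_def by blast
    have s: "0 < s" "d \<le> s" using d0 assms(2) unfolding s_def d_def by simp_all
    have "d \<le> diam" unfolding d_def using W\<gamma> compact_imp_bounded[OF comp] by (rule diameter_subset)
    then have sM: "s \<le> (1 + C) * diam" using assms(2) unfolding s_def by simp
    have "dist p (z i) \<le> C * d"
    proof -
      have "dist p (z i) \<le> C * dist p q" using junction_turningD(1)[OF jt i] p q by blast
      also have "\<dots> \<le> C * d" using Wd p q assms(2) by (intro mult_left_mono) auto
      finally show ?thesis .
    qed
    then have Wz: "x \<in> cball (z i) s" if "x \<in> W" for x
    proof -
      have "dist (z i) x \<le> dist p (z i) + dist x p"
        using dist_triangle[of "z i" x p] by (simp add: dist_commute)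
      also have "\<dots> \<le> s" using \<open>dist p (z i) \<le> C * d\<close> Wd[OF that, of p] p
        unfolding s_def by (simp add: algebra_simps)
      finally show ?thesis by simp
    qed
    obtain g l where g: "g ` cell i \<subseteq> cell i" "g (z i) = z i" "cell i \<inter> cball (z i) s \<subseteq> g ` cell i"
      and l: "s / K \<le> l" "l \<le> K * s"
      and gd: "\<forall>x\<in>cell i. \<forall>y\<in>cell i. dist (g x) (g y) = l * dist x y"
      using K(2)[OF iN(1) _ s(1) sM, of b] unfolding z_def by auto
    have "\<exists>g l. g ` cell (Suc i) \<subseteq> cell (Suc i) \<and> g (z i) = z i \<and>
        cell (Suc i) \<inter> cball (z i) s \<subseteq> g ` cell (Suc i) \<and> s / K \<le> l \<and> l \<le> K * s \<and>
        (\<forall>x\<in>cell (Suc i). \<forall>y\<in>cell (Suc i). dist (g x) (g y) = l * dist x y)"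
      using K(2)[OF iN(2) _ s(1) sM, of a] unfolding z_Suc[OF i] by simp
    then obtain g' l' where g': "g' ` cell (Suc i) \<subseteq> cell (Suc i)" "g' (z i) = z i"
        "cell (Suc i) \<inter> cball (z i) s \<subseteq> g' ` cell (Suc i)"
      and l': "s / K \<le> l'" "l' \<le> K * s"
      and gd': "\<forall>x\<in>cell (Suc i). \<forall>y\<in>cell (Suc i). dist (g' x) (g' y) = l' * dist x y"
      by blast
    have sK: "0 < s / K" using s K by simp
    have l0: "0 < l" "0 < l'" using sK l(1) l'(1) by linarith+
    obtain h where h: "\<And>x. x \<in> cell i \<inter> cball (z i) s \<Longrightarrow> h x \<in> cell i" "h (z i) = z i"
      "\<And>x y. \<lbrakk>x \<in> cell i \<inter> cball (z i) s; y \<in> cell i \<inter> cball (z i) s\<rbrakk> \<Longrightarrow> dist (h x) (h y) = dist x y / l"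
      "\<And>x. x \<in> cell i \<inter> cball (z i) s \<Longrightarrow> dist (h x) (z i) = dist x (z i) / l"
      using inverse_zoom[OF g(1) z_mem(1)[OF i] g(2,3) l0(1) gd] by blast
    obtain h' where h': "\<And>x. x \<in> cell (Suc i) \<inter> cball (z i) s \<Longrightarrow> h' x \<in> cell (Suc i)" "h' (z i) = z i"
      "\<And>x y. \<lbrakk>x \<in> cell (Suc i) \<inter> cball (z i) s; y \<in> cell (Suc i) \<inter> cball (z i) s\<rbrakk> \<Longrightarrow>
          dist (h' x) (h' y) = dist x y / l'"
      "\<And>x. x \<in> cell (Suc i) \<inter> cball (z i) s \<Longrightarrow> dist (h' x) (z i) = dist x (z i) / l'"
      using inverse_zoom[OF g'(1) z_mem(2)[OF i] g'(2,3) l0(2) gd'] by blast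
    \<comment> \<open>At \<open>z i\<close>, the only point in both cells, \<open>h\<close> and
      \<open>h'\<close> agree.\<close>
    define \<phi> where "\<phi> x = (if x \<in> cell i then h x else h' x)" for x
    have up: "t / m \<le> (K * t) / d" and lo: "t / (K * (1 + C) * d) \<le> t / m"
      if "0 \<le> t" "s / K \<le> m" "m \<le> K * s" for t m
    proof -
      have d: "0 < d" using d0 unfolding d_def .
      have m: "0 < m" using sK that(2) by linarith
      have "d \<le> K * m" using that(2) s(2) K(1) by (simp add: field_simps)
      then have "t * d \<le> t * (K * m)" using that(1) by (rule mult_left_mono)
      then show "t / m \<le> (K * t) / d" using m d by (simp add: field_simps)
      have "K * s = K * (1 + C) * d" unfolding s_def by simp
      then show "t / (K * (1 + C) * d) \<le> t / m" using that m by (intro divide_left_mono) auto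
    qed
    have dpos: "0 < d" using d0 unfolding d_def .
    have same: "1 / H * t / d \<le> t / m \<and> t / m \<le> H * t / d"
      if "0 \<le> t" "s / K \<le> m" "m \<le> K * s" for t m
    proof
      have "1 / H * t / d = t / (H * d)" by simp
      also have "\<dots> \<le> t / (K * (1 + C) * d)"
        using that(1) H K(1) assms(2) dpos by (intro divide_left_mono mult_right_mono) auto
      finally show "1 / H * t / d \<le> t / m" using lo[OF that] by simp
      have "K * t / d \<le> H * t / d"
        using H that(1) dpos by (intro divide_right_mono mult_right_mono) auto
      then show "t / m \<le> H * t / d" using up[OF that] by simp
    qed
    have cross: "1 / H * dist x y / d \<le> dist (h x) (h' y) \<and> dist (h x) (h' y) \<le> H * dist x y / d"
      if x: "x \<in> W" "x \<in> cell i" and y: "y \<in> W" "y \<in> cell (Suc i)" for x y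
    proof
      let ?z = "z i"
      have xb: "x \<in> cell i \<inter> cball ?z s" and yb: "y \<in> cell (Suc i) \<inter> cball ?z s"
        using x y Wz by auto
      have xy: "dist x ?z + dist y ?z \<le> (1 + 2 * C) * dist x y"
        using junction_turningD[OF jt i x(2) y(2)] by (simp add: algebra_simps)
      \<comment> \<open>The images lie again in cells \<open>i\<close> and \<open>Suc i\<close>, so
        the estimate applies to them too. This gives the lower bound, \<open>xy\<close> the upper
        one.\<close>
      have hxy: "dist (h x) ?z + dist (h' y) ?z \<le> (1 + 2 * C) * dist (h x) (h' y)"
        using junction_turningD[OF jt i h(1)[OF xb] h'(1)[OF yb]] by (simp add: algebra_simps)
      have "dist (h x) (h' y) \<le> dist (h x) ?z + dist (h' y) ?z"
        by (metis dist_commute dist_triangle)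
      also have "\<dots> = dist x ?z / l + dist y ?z / l'" using h(4)[OF xb] h'(4)[OF yb] by simp
      also have "\<dots> \<le> (K * dist x ?z) / d + (K * dist y ?z) / d"
        using up l l' by (intro add_mono) auto
      also have "\<dots> = K * (dist x ?z + dist y ?z) / d"
        by (simp add: distrib_left add_divide_distrib)
      also have "\<dots> \<le> K * ((1 + 2 * C) * dist x y) / d"
        using xy K(1) dpos by (intro divide_right_mono mult_left_mono) auto
      also have "\<dots> = (K * (1 + 2 * C)) * dist x y / d" by simp
      also have "\<dots> \<le> H * dist x y / d"
        using H dpos by (intro divide_right_mono mult_right_mono) auto
      finally show "dist (h x) (h' y) \<le> H * dist x y / d" .
      have "dist x y / (K * (1 + C) * d) \<le> (dist x ?z + dist y ?z) / (K * (1 + C) * d)"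
        using K(1) assms(2) dpos by (intro divide_right_mono) (auto simp: dist_triangle2)
      also have "\<dots> \<le> dist x ?z / l + dist y ?z / l'"
        unfolding add_divide_distrib using lo l l' by (intro add_mono) auto
      also have "\<dots> = dist (h x) ?z + dist (h' y) ?z" using h(4)[OF xb] h'(4)[OF yb] by simp
      also have "\<dots> \<le> (1 + 2 * C) * dist (h x) (h' y)" by (rule hxy)
      finally have "dist x y / (K * (1 + C) * d) \<le> dist (h x) (h' y) * (1 + 2 * C)"
        by (simp only: mult.commute)
      moreover have "0 < 1 + 2 * C" using assms(2) by simp
      ultimately have "dist x y / (K * (1 + C) * d) / (1 + 2 * C) \<le> dist (h x) (h' y)"
        using pos_divide_le_eq by blast
      moreover have "1 / H * dist x y / d = dist x y / (K * (1 + C) * d) / (1 + 2 * C)"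
        unfolding H_def by (simp add: mult_ac)
      ultimately show "1 / H * dist x y / d \<le> dist (h x) (h' y)" by metis
    qed
    have "1 / H * dist x y / d \<le> dist (\<phi> x) (\<phi> y) \<and> dist (\<phi> x) (\<phi> y) \<le> H * dist x y / d"
      if xy: "x \<in> W" "y \<in> W" for x y
    proof -
      consider "x \<in> cell i" "y \<in> cell i" | "x \<in> cell i" "y \<notin> cell i" | "x \<notin> cell i" "y \<in> cell i"
        | "x \<notin> cell i" "y \<notin> cell i" by blast
      then show ?thesis
      proof cases
        case 1
        then show ?thesis
          unfolding \<phi>_def using h(3)[of x y] Wz xy same[OF _ l, of "dist x y"] by simp
      next
        case 2
        then have "y \<in> cell (Suc i)" using W xy by blast
        with 2 show ?thesis unfolding \<phi>_def using cross xy by simp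
      next
        case 3
        then have "x \<in> cell (Suc i)" using W xy by blast
        with 3 show ?thesis unfolding \<phi>_def using cross[of y x] xy by (simp add: dist_commute)
      next
        case 4
        then have "x \<in> cell (Suc i)" "y \<in> cell (Suc i)" using W xy by blast+
        with 4 show ?thesis
          unfolding \<phi>_def using h'(3)[of x y] Wz xy same[OF _ l', of "dist x y"] by simp
      qed
    qed
    moreover have "\<phi> ` W \<subseteq> \<gamma>"
    proof
      fix v assume "v \<in> \<phi> ` W"
      then obtain x where x: "x \<in> W" "v = \<phi> x" by blast
      have "\<phi> x \<in> cell i \<or> \<phi> x \<in> cell (Suc i)"
        unfolding \<phi>_def using h(1)[of x] h'(1)[of x] Wz[OF x(1)] x(1) W by auto
      then show "v \<in> \<gamma>" using x(2) cell_subset[OF iN(1)] cell_subset[OF iN(2)] by blast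
    qed
    ultimately show "blows_up W (1 / H) H"
      unfolding blows_up_def d_def by blast
  qed
qed

lemma blows_up_mono:
  assumes "blows_up W C1 C2" "C1' \<le> C1" "C2 \<le> C2'" "0 < diameter W"
  shows "blows_up W C1' C2'"
proof -
  have 1: "C1' * t / diameter W \<le> C1 * t / diameter W" if "0 \<le> t" for t
    using assms that by (intro divide_right_mono mult_right_mono) auto
  have 2: "C2 * t / diameter W \<le> C2' * t / diameter W" if "0 \<le> t" for t
    using assms that by (intro divide_right_mono mult_right_mono) auto
  obtain \<phi> where \<phi>: "\<phi> ` W \<subseteq> \<gamma>" "\<forall>x\<in>W. \<forall>y\<in>W.
     C1 * dist x y / diameter W \<le> dist (\<phi> x) (\<phi> y) \<and>
     dist (\<phi> x) (\<phi> y) \<le> C2 * dist x y / diameter W"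
    using assms(1) unfolding blows_up_def by blast
  have "C1' * dist x y / diameter W \<le> dist (\<phi> x) (\<phi> y) \<and>
     dist (\<phi> x) (\<phi> y) \<le> C2' * dist x y / diameter W" if "x \<in> W" "y \<in> W" for x y
    using \<phi>(2) that 1[of "dist x y"] 2[of "dist x y"] by (meson order_trans zero_le_dist)
  then show ?thesis unfolding blows_up_def using \<phi>(1) by blast
qed

text \<open>A set inside one cell is pulled back. Any other set either has diameter at least
  \<delta>, and the identity will do, or it meets just two adjacent cells.\<close>

lemma junction_turning_imp_blows_up:
  assumes jt: "junction_turning C" and "0 < C"
  obtains C1 C2 where "0 < C1" "0 < C2"
    "\<And>W. \<lbrakk>W \<subseteq> \<gamma>; 0 < diameter W\<rbrakk> \<Longrightarrow> blows_up W C1 C2"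
proof -
  obtain \<delta> where \<delta>: "0 < \<delta>"
    "\<And>i j x y. \<lbrakk>i \<in> {1..N}; j \<in> {1..N}; Suc i < j; x \<in> cell i; y \<in> cell j\<rbrakk> \<Longrightarrow> \<delta> \<le> dist x y"
    using cell_gap by blast
  obtain B1 B2 where B: "0 < B1" "0 < B2"
    "\<And>i W p q. \<lbrakk>i \<in> {1..N-1}; W \<subseteq> cell i \<union> cell (Suc i); 0 < diameter W;
        p \<in> W \<inter> cell i; q \<in> W \<inter> cell (Suc i)\<rbrakk> \<Longrightarrow> blows_up W B1 B2"
    using blows_up_across_junction[OF assms] by blast
  \<comment> \<open>\<delta> and \<open>diam\<close> are the constants of the identity, used when
    \<open>\<delta> \<le> diameter W \<le> diam\<close>.\<close>
  define C1 where "C1 = min \<delta> B1"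
  define C2 where "C2 = max diam B2"
  have far: "blows_up W C1 C2" if W: "W \<subseteq> \<gamma>" and "\<delta> \<le> diameter W" for W
  proof -
    have d: "0 < diameter W" "C1 / diameter W \<le> 1" using that \<delta>(1) unfolding C1_def by auto
    have "diameter W \<le> C2"
      using diameter_subset[OF W compact_imp_bounded[OF comp]] unfolding C2_def by simp
    then have "1 \<le> C2 / diameter W" using d by simp
    then have "C1 / diameter W * dist x y \<le> 1 * dist x y \<and> 1 * dist x y \<le> C2 / diameter W * dist x y" for x y
      using d by (intro conjI mult_right_mono) auto
    then show ?thesis unfolding blows_up_def using W by (intro exI[of _ id]) auto
  qed
  have near: "blows_up W C1 C2" if W: "W \<subseteq> \<gamma>" "0 < diameter W"
    and noncell: "\<And>i. i \<in> {1..N} \<Longrightarrow> \<not> W \<subseteq> cell i" for W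
  proof (cases "diameter W < \<delta>")
    case True
    define I where "I = {i\<in>{1..N}. W \<inter> cell i \<noteq> {}}"
    have bW: "bounded W" using W bounded_subset compact_imp_bounded[OF comp] by blast
    have "W \<noteq> {}" using W(2) by auto
    then obtain x where x: "x \<in> W" "x \<in> \<gamma>" using W(1) by blast
    then obtain j where "j \<in> {1..N}" "x \<in> cell j" using cellE by blast
    then have "j \<in> I" using x(1) unfolding I_def by blast
    then have "I \<noteq> {}" by blast
    \<comment> \<open>The lowest cell that \<open>W\<close> meets; points of cells beyond the next
      one would be at distance at least \<delta>.\<close>
    define i where "i = Min I"
    have fI: "finite I" unfolding I_def by simp
    have iI: "i \<in> I" unfolding i_def using fI \<open>I \<noteq> {}\<close> by (rule Min_in)
    then obtain p where p: "p \<in> W" "p \<in> cell i" and i: "i \<in> {1..N}" unfolding I_def by blast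
    have I2: "j = i \<or> j = Suc i" if j: "j \<in> I" for j
    proof (rule ccontr)
      assume "\<not> (j = i \<or> j = Suc i)"
      moreover have "i \<le> j" unfolding i_def using fI j by (rule Min_le)
      ultimately have "Suc i < j" by simp
      moreover obtain q where q: "q \<in> W" "q \<in> cell j" "j \<in> {1..N}" using j unfolding I_def by blast
      ultimately have "\<delta> \<le> dist p q" using \<delta>(2)[OF i, of j p q] p by blast
      also have "\<dots> \<le> diameter W" using diameter_bounded_bound[OF bW] p q by blast
      finally show False using True by simp
    qed
    have W2: "x \<in> cell i \<or> Suc i \<in> I \<and> x \<in> cell (Suc i)" if "x \<in> W" for x
    proof -
      have "x \<in> \<gamma>" using W(1) that by blast
      then obtain j where "j \<in> {1..N}" "x \<in> cell j" by (rule cellE)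
      then have "j \<in> I" using that unfolding I_def by blast
      then show ?thesis using I2 \<open>x \<in> cell j\<close> by metis
    qed
    then have "Suc i \<in> I" using noncell[OF i] by blast
    then obtain q where q: "q \<in> W" "q \<in> cell (Suc i)" "Suc i \<in> {1..N}" unfolding I_def by blast
    have "W \<subseteq> cell i \<union> cell (Suc i)" using W2 by blast
    moreover have "i \<in> {1..N-1}" using i q by auto
    ultimately have "blows_up W B1 B2" using B(3)[of i W p q] W(2) p q by blast
    then show ?thesis by (rule blows_up_mono) (use W in \<open>auto simp: C1_def C2_def\<close>)
  qed (use far W in auto)
  have "blows_up W C1 C2" if "0 < s" "s = diameter W" "W \<subseteq> \<gamma>" for s W
    using that
  proof (induction s arbitrary: W rule: scale_induct)
    case (large s)
    then show ?case using diameter_subset[OF _ compact_imp_bounded[OF comp], of W] by simp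
  next
    case (small s)
    show ?case
    proof (cases "\<exists>i\<in>{1..N}. W \<subseteq> cell i")
      case True
      then obtain i where i: "i \<in> {1..N}" "W \<subseteq> cell i" by blast
      then have "blows_up (pull i ` W) C1 C2"
        using small.prems pull_mem diameter_pull[OF i] by (intro small.IH[OF i(1)]) auto
      then show ?thesis by (rule blows_up_pull[OF i])
    next
      case False
      then show ?thesis using near small.prems small.hyps by blast
    qed
  qed
  then show ?thesis using that[of C1 C2] \<delta>(1) B diam_pos unfolding C1_def C2_def by auto
qed

section \<open>The junction estimate from condition (1)\<close>

text \<open>If \<open>p\<close> and \<open>q\<close> on the two sides of a junction were much closer to each other than to the
  junction, blowing up a ball around the junction would give two continua in \<open>\<gamma>\<close> with one common
  point whose far ends are almost equal; a small continuum joining these ends would then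
  violate \<open>connected_Int\<close>.\<close>

lemma blows_up_imp_junction_turning_at:
  assumes "0 < r0" "0 < C1" "0 < C2"
    and bu: "\<And>U. \<lbrakk>open U; 0 < diameter (U \<inter> \<gamma>); diameter (U \<inter> \<gamma>) < r0\<rbrakk> \<Longrightarrow> blows_up (U \<inter> \<gamma>) C1 C2"
    and i: "i \<in> {1..N-1}"
  shows "\<exists>C>0. \<forall>p\<in>cell i. \<forall>q\<in>cell (Suc i). dist p (z i) \<le> C * dist p q"
proof -
  have iN: "i \<in> {1..N}" "Suc i \<in> {1..N}" using i by auto
  obtain K where K: "1 \<le> K"
    "\<And>i c p. \<lbrakk>i \<in> {1..N}; c \<in> {a, b}; p \<in> cell i\<rbrakk> \<Longrightarrow>
      \<exists>E. compact E \<and> connected E \<and> E \<subseteq> cell i \<and> p \<in> E \<and> S i c \<in> E \<and>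
        (\<forall>x\<in>E. \<forall>y\<in>E. dist x y \<le> K * dist p (S i c))"
    using end_continuum by blast
  \<comment> \<open>The images of \<open>p\<close> and \<open>z i\<close> will be at least
    \<open>C1 * s / d\<close> apart, where \<open>d \<le> 6 * K * s\<close>; a continuum of size
    below \<eta> cannot contain both.\<close>
  define \<eta> where "\<eta> = C1 / (6 * K)"
  have \<eta>: "0 < \<eta>" using assms K unfolding \<eta>_def by simp
  obtain \<delta> where \<delta>: "0 < \<delta>"
    "\<And>x y. \<lbrakk>x \<in> \<gamma>; y \<in> \<gamma>; dist x y < \<delta>\<rbrakk> \<Longrightarrow>
      \<exists>G. compact G \<and> connected G \<and> G \<subseteq> \<gamma> \<and> x \<in> G \<and> y \<in> G \<and> (\<forall>u\<in>G. \<forall>v\<in>G. dist u v < \<eta>)"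
    using small_continuum[OF \<eta>] by blast
  \<comment> \<open>If \<open>dist p q < \<kappa> * s\<close>, the images of \<open>p\<close> and
    \<open>q\<close> are closer than \<open>C2 * \<kappa> \<le> \<delta>\<close>, as
    \<open>s \<le> d\<close>. The \<open>1\<close> keeps \<open>q\<close> within
    \<open>2 * s\<close> of the junction.\<close>
  define \<kappa> where "\<kappa> = min 1 (\<delta> / C2)"
  have \<kappa>: "0 < \<kappa>" "\<kappa> \<le> 1" "C2 * \<kappa> \<le> \<delta>"
    using \<delta>(1) assms(3) unfolding \<kappa>_def by (auto simp: field_simps min_def)
  \<comment> \<open>Makes the diameter of \<open>W\<close> below, at most \<open>6 * K * s\<close>,
    smaller than \<open>r0\<close>.\<close>
  define s0 where "s0 = r0 / (6 * K)"
  have s0: "0 < s0" using assms(1) K unfolding s0_def by simp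
  have near: "\<kappa> * dist p (z i) \<le> dist p q"
    if p: "p \<in> cell i" and q: "q \<in> cell (Suc i)" and small: "dist p (z i) < s0" for p q
  proof (rule ccontr)
    define s where "s = dist p (z i)"
    assume "\<not> \<kappa> * dist p (z i) \<le> dist p q"
    then have e: "dist p q < \<kappa> * s" unfolding s_def by simp
    have s: "0 < s" "s < s0"
    proof -
      have "0 < \<kappa> * s" using e zero_le_dist[of p q] by linarith
      then show "0 < s" using \<kappa>(1) zero_less_mult_pos by blast
      show "s < s0" using small unfolding s_def .
    qed
    have "\<kappa> * s \<le> 1 * s" using \<kappa> s by (intro mult_right_mono) auto
    then have qz: "dist q (z i) < 2 * s"
      using e dist_triangle[of q "z i" p] unfolding s_def by (simp add: dist_commute)
    obtain E1 where E1: "compact E1" "connected E1" "E1 \<subseteq> cell i" "p \<in> E1" "z i \<in> E1"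
        "\<forall>x\<in>E1. \<forall>y\<in>E1. dist x y \<le> K * s"
      using K(2)[OF iN(1) _ p, of b] unfolding z_def s_def by auto
    obtain E2 where E2: "compact E2" "connected E2" "E2 \<subseteq> cell (Suc i)" "q \<in> E2" "z i \<in> E2"
        "\<forall>x\<in>E2. \<forall>y\<in>E2. dist x y \<le> K * dist q (z i)"
      using K(2)[OF iN(2) _ q, of a] z_Suc[OF i] by auto
    \<comment> \<open>\<open>E1\<close> stays within \<open>K * s\<close> of \<open>z i\<close> and
      \<open>E2\<close> within \<open>2 * K * s\<close>, so this open ball contains both.\<close>
    define U where "U = ball (z i) (3 * K * s)"
    define W where "W = U \<inter> \<gamma>"
    have Ks: "0 < K * s" using K(1) s by simp
    have sub: "E1 \<subseteq> W" "E2 \<subseteq> W"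
    proof -
      have "dist (z i) x < 3 * K * s" if "x \<in> E1" for x
      proof -
        have "dist (z i) x \<le> K * s" using E1(5,6) that by blast
        then show ?thesis using Ks by simp
      qed
      then show "E1 \<subseteq> W" using E1(3) cell_subset[OF iN(1)] unfolding U_def W_def by auto
      have "dist (z i) x < 3 * K * s" if "x \<in> E2" for x
      proof -
        have "dist (z i) x \<le> K * dist q (z i)" using E2(5,6) that by blast
        also have "\<dots> \<le> K * (2 * s)" using qz K(1) by (intro mult_left_mono) auto
        finally show ?thesis using Ks by simp
      qed
      then show "E2 \<subseteq> W" using E2(3) cell_subset[OF iN(2)] unfolding U_def W_def by auto
    qed
    define d where "d = diameter W"
    have "bounded W" unfolding W_def using compact_imp_bounded[OF comp] by blast
    then have "dist p (z i) \<le> d"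
      using diameter_bounded_bound[of W p "z i"] sub E1(4,5) unfolding d_def by blast
    then have "s \<le> d" unfolding s_def .
    then have d: "s \<le> d" "0 < d" using s by auto
    have "diameter W \<le> 6 * (K * s)"
    proof (rule diameter_le)
      show "W \<noteq> {} \<or> 0 \<le> 6 * (K * s)" using Ks by simp
      fix x y assume "x \<in> W" "y \<in> W"
      then have "dist (z i) x < 3 * K * s" "dist (z i) y < 3 * K * s"
        unfolding W_def U_def by auto
      then show "norm (x - y) \<le> 6 * (K * s)"
        using dist_triangle3[of x y "z i"] unfolding dist_norm[of x y] by simp
    qed
    then have dK: "d \<le> 6 * K * s" unfolding d_def by simp
    have "6 * K * s < 6 * K * s0" using s K(1) by (intro mult_strict_left_mono) auto
    also have "\<dots> = r0" using K(1) unfolding s0_def by simp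
    finally have "d < r0" using dK by linarith
    then have "blows_up W C1 C2" using bu[of U] d unfolding W_def U_def d_def by simp
    then obtain \<phi> where \<phi>W: "\<phi> ` W \<subseteq> \<gamma>"
      and \<phi>: "\<And>x y. \<lbrakk>x \<in> W; y \<in> W\<rbrakk> \<Longrightarrow> C1 * dist x y / d \<le> dist (\<phi> x) (\<phi> y)"
        "\<And>x y. \<lbrakk>x \<in> W; y \<in> W\<rbrakk> \<Longrightarrow> dist (\<phi> x) (\<phi> y) \<le> C2 * dist x y / d"
      unfolding blows_up_def d_def by blast
    have cont: "continuous_on W \<phi>"
      using \<phi>(2) assms(3) d(2) by (intro lipschitz_on_continuous_on[of "C2 / d"] lipschitz_onI) auto
    have inj: "inj_on \<phi> W"
    proof (rule inj_onI)
      fix x y assume xy: "x \<in> W" "y \<in> W" "\<phi> x = \<phi> y"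
      then have "C1 * dist x y / d \<le> 0" using \<phi>(1)[of x y] by simp
      then show "x = y" using assms(2) d(2) by (simp add: field_simps mult_le_0_iff)
    qed
    define u where "u = \<phi> (z i)"
    define L where "L = \<phi> ` E1"
    define R where "R = \<phi> ` E2"
    have LR: "compact L" "connected L" "compact R" "connected R"
      using E1(1,2) E2(1,2) sub continuous_on_subset[OF cont] unfolding L_def R_def
      by (auto intro!: compact_continuous_image connected_continuous_image)
    have LR\<gamma>: "L \<subseteq> \<gamma>" "R \<subseteq> \<gamma>" using sub \<phi>W unfolding L_def R_def by blast+
    have "L \<inter> R = \<phi> ` (E1 \<inter> E2)"
      using inj_on_image_Int[OF inj sub] unfolding L_def R_def by simp
    moreover have "E1 \<inter> E2 = {z i}" using E1(3,5) E2(3,5) adjacent_z[OF i] by blast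
    ultimately have LRu: "L \<inter> R = {u}" unfolding u_def by simp
    have mem: "\<phi> p \<in> L" "\<phi> q \<in> R" "u \<in> L" "u \<in> R"
      using E1 E2 unfolding L_def R_def u_def by auto
    have pqW: "p \<in> W" "q \<in> W" "z i \<in> W" using sub E1 E2 by auto
    have "dist (\<phi> p) (\<phi> q) < \<delta>"
    proof -
      have "dist (\<phi> p) (\<phi> q) \<le> C2 * dist p q / d" using \<phi>(2) pqW by blast
      also have "\<dots> < C2 * (\<kappa> * s) / d"
        using e assms(3) d(2) by (intro divide_strict_right_mono mult_strict_left_mono) auto
      also have "\<dots> \<le> C2 * (\<kappa> * d) / d"
        using \<kappa>(1) d assms(3) by (intro divide_right_mono mult_left_mono) auto
      also have "\<dots> = C2 * \<kappa>" using d by simp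
      finally show ?thesis using \<kappa>(3) by simp
    qed
    then obtain G where G: "compact G" "connected G" "G \<subseteq> \<gamma>" "\<phi> p \<in> G" "\<phi> q \<in> G"
        "\<forall>u\<in>G. \<forall>v\<in>G. dist u v < \<eta>"
      using \<delta>(2)[of "\<phi> p" "\<phi> q"] mem LR\<gamma> by blast
    have "\<eta> \<le> dist (\<phi> p) u"
    proof -
      have "\<eta> = C1 * s / (6 * K * s)" using s unfolding \<eta>_def by simp
      also have "\<dots> \<le> C1 * s / d"
        using dK d(2) assms(2) s Ks by (intro divide_left_mono) auto
      also have "\<dots> \<le> dist (\<phi> p) u" using \<phi>(1)[OF pqW(1,3)] unfolding s_def u_def .
      finally show ?thesis .
    qed
    then have uG: "u \<notin> G" using G(4,6) by fastforce
    \<comment> \<open>The intersection is the union of \<open>{u}\<close> and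
      \<open>G \<inter> R\<close>, both closed. They are disjoint since \<open>u\<close> is not in
      \<open>G\<close>, and the second contains \<open>\<phi> q\<close>.\<close>
    have "connected ((L \<union> G) \<inter> R)"
    proof (rule connected_Int)
      have "L \<inter> G \<noteq> {}" using mem G by blast
      then show "connected (L \<union> G)" using LR G by (intro connected_Un)
      show "compact (L \<union> G)" "L \<union> G \<subseteq> \<gamma>" using LR LR\<gamma> G by auto
    qed (use LR LR\<gamma> in auto)
    moreover have "closed {u}" "closed G" using G compact_imp_closed by auto
    moreover have "(L \<union> G) \<inter> R \<subseteq> {u} \<union> G" using LRu by blast
    moreover have "{u} \<inter> G \<inter> ((L \<union> G) \<inter> R) = {}" using uG by blast
    moreover have "{u} \<inter> ((L \<union> G) \<inter> R) \<noteq> {}" using mem by blast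
    moreover have "G \<inter> ((L \<union> G) \<inter> R) \<noteq> {}" using G(5) mem(2) by blast
    ultimately show False unfolding connected_closed by blast
  qed
  \<comment> \<open>Away from the junction compactness suffices: the rest of cell \<open>i\<close>
    misses cell \<open>Suc i\<close>, hence has a positive distance from it.\<close>
  have "(cell i - ball (z i) s0) \<inter> cell (Suc i) = cell i \<inter> cell (Suc i) - ball (z i) s0"
    by blast
  then have sep: "(cell i - ball (z i) s0) \<inter> cell (Suc i) = {}"
    using adjacent_z[OF i] s0 by simp
  have cl: "compact (cell i - ball (z i) s0)" "closed (cell (Suc i))"
    using compact_cell[OF iN(1)] compact_imp_closed[OF compact_cell[OF iN(2)]]
    by (auto intro: compact_diff)
  obtain \<delta>' where \<delta>': "0 < \<delta>'"
      "\<forall>p\<in>cell i - ball (z i) s0. \<forall>q\<in>cell (Suc i). \<delta>' \<le> dist p q"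
    using separate_compact_closed[OF cl sep] by metis
  define C where "C = max (1 / \<kappa>) (diam / \<delta>')"
  have C: "1 / \<kappa> \<le> C" "diam / \<delta>' \<le> C" unfolding C_def by auto
  have C0: "0 < C" using \<kappa>(1) C(1) less_le_trans[of 0 "1 / \<kappa>" C] by simp
  have "dist p (z i) \<le> C * dist p q" if p: "p \<in> cell i" and q: "q \<in> cell (Suc i)" for p q
  proof (cases "dist p (z i) < s0")
    case True
    have "dist p (z i) \<le> (1 / \<kappa>) * dist p q" using near[OF p q True] \<kappa>(1) by (simp add: field_simps)
    also have "\<dots> \<le> C * dist p q" using C by (intro mult_right_mono) auto
    finally show ?thesis .
  next
    case False
    then have "p \<in> cell i - ball (z i) s0" using p by (simp add: dist_commute)
    then have "\<delta>' \<le> dist p q" using \<delta>'(2) q by blast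
    have "p \<in> \<gamma>" using p cell_subset[OF iN(1)] by blast
    then have "dist p (z i) \<le> (diam / \<delta>') * \<delta>'"
      using dist_le_diam[OF _ z_mem(3)[OF i]] \<delta>'(1) by simp
    also have "\<dots> \<le> C * dist p q"
      using C C0 \<delta>'(1) \<open>\<delta>' \<le> dist p q\<close> by (intro mult_mono) auto
    finally show ?thesis .
  qed
  then show ?thesis using C0 by blast
qed

lemma blows_up_imp_junction_turning:
  assumes "0 < r0" "0 < C1" "0 < C2"
    and "\<And>U. \<lbrakk>open U; 0 < diameter (U \<inter> \<gamma>); diameter (U \<inter> \<gamma>) < r0\<rbrakk> \<Longrightarrow> blows_up (U \<inter> \<gamma>) C1 C2"
  shows "\<exists>C>0. junction_turning C"
proof -
  obtain c where c: "\<And>i. i \<in> {1..N-1} \<Longrightarrow> 0 < c i \<and>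
      (\<forall>p\<in>cell i. \<forall>q\<in>cell (Suc i). dist p (z i) \<le> c i * dist p q)"
    using blows_up_imp_junction_turning_at[OF assms] by metis
  define C where "C = 1 + (\<Sum>i\<in>{1..N-1}. c i)"
  have cC: "c i \<le> C" if "i \<in> {1..N-1}" for i
  proof -
    have "c i \<le> (\<Sum>i\<in>{1..N-1}. c i)" using that c by (intro member_le_sum) (auto intro: less_imp_le)
    then show ?thesis unfolding C_def by simp
  qed
  have "dist p (z i) \<le> C * dist p q"
    if i: "i \<in> {1..N-1}" and "p \<in> cell i" "q \<in> cell (Suc i)" for i p q
  proof -
    have "dist p (z i) \<le> c i * dist p q" using c that by blast
    also have "\<dots> \<le> C * dist p q" using cC[OF i] by (intro mult_right_mono) auto
    finally show ?thesis .
  qed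
  then have "junction_turning C" unfolding junction_turning_def by blast
  moreover have "0 < C"
    unfolding C_def using c by (intro add_pos_nonneg sum_nonneg) (auto intro: less_imp_le)
  ultimately show ?thesis by blast
qed

end

section \<open>The degenerate case and the equivalence\<close>

text \<open>A point of \<gamma> farthest from \<open>a\<close> is the image of a point of \<gamma>
  under some \<open>S i\<close>, which contracts towards \<open>a\<close>; so the largest distance
  is \<open>0\<close>.\<close>

lemma IFS_invariant_singleton:
  assumes inv: "IFS_invariant N S \<gamma>" and fixed: "\<And>i. i \<in> {1..N} \<Longrightarrow> S i a = a"
  shows "\<gamma> = {a}"
proof -
  have \<gamma>: "compact \<gamma>" "\<gamma> \<noteq> {}" "\<gamma> = (\<Union>i\<in>{1..N}. S i ` \<gamma>)"
    and sim: "\<And>i. i \<in> {1..N} \<Longrightarrow> contracting_similarity (S i)"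
    using inv unfolding IFS_invariant_def by auto
  obtain x where x: "x \<in> \<gamma>" "\<And>y. y \<in> \<gamma> \<Longrightarrow> dist a y \<le> dist a x"
    using distance_attains_sup[OF \<gamma>(1,2), of a] by blast
  obtain i y where i: "i \<in> {1..N}" and y: "y \<in> \<gamma>" "x = S i y" using x(1) \<gamma>(3) by blast
  obtain r where r: "0 < r" "r < 1" "\<And>x y. dist (S i x) (S i y) = r * dist x y"
    using sim[OF i] unfolding contracting_similarity_def by blast
  have "dist a x = r * dist a y" using r(3)[of a y] fixed[OF i] y(2) by simp
  also have "\<dots> \<le> r * dist a x" using x(2)[OF y(1)] r(1) by (intro mult_left_mono) auto
  finally have "dist a x \<le> 0"
    using mult_strict_right_mono[OF r(2), of "dist a x"] by (cases "0 < dist a x") auto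
  then have "y = a" if "y \<in> \<gamma>" for y using x(2)[OF that] by simp
  then show ?thesis using \<gamma>(2) by blast
qed

theorem theorem5p6:
  fixes N :: nat and S :: "nat \<Rightarrow> 'a::euclidean_space \<Rightarrow> 'a" and \<gamma> :: "'a set"
  assumes "IFS_arc N S \<gamma>"
  shows "bounded_turning \<gamma> \<longleftrightarrow>
    ((\<exists>r0>0. \<exists>C1>0. \<exists>C2>0. \<forall>U. open U \<and> U \<inter> \<gamma> \<noteq> {} \<and>
        0 < diameter (U \<inter> \<gamma>) \<and> diameter (U \<inter> \<gamma>) < r0 \<longrightarrow>
        (\<exists>\<phi>. \<phi> ` (U \<inter> \<gamma>) \<subseteq> \<gamma> \<and>
          (\<forall>a\<in>U \<inter> \<gamma>. \<forall>b\<in>U \<inter> \<gamma>.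
             C1 * dist a b / diameter (U \<inter> \<gamma>) \<le> dist (\<phi> a) (\<phi> b) \<and>
             dist (\<phi> a) (\<phi> b) \<le> C2 * dist a b / diameter (U \<inter> \<gamma>)))) \<and>
     (\<exists>r1>0. \<exists>C3>0. \<forall>x\<in>\<gamma>. \<forall>r. 0 < r \<and> r < r1 \<longrightarrow>
        (\<exists>\<psi>. \<psi> ` \<gamma> \<subseteq> ball x r \<inter> \<gamma> \<and>
          (\<forall>a\<in>\<gamma>. \<forall>b\<in>\<gamma>. dist (\<psi> a) (\<psi> b) \<ge> C3 * r * dist a b))))"
  (is "_ \<longleftrightarrow> ?expand \<and> ?embed")
proof -
  obtain a b where path: "IFS_path N S \<gamma> a b"
    and adj: "\<forall>i\<in>{1..N-1}. S i ` \<gamma> \<inter> S (Suc i) ` \<gamma> = {S (Suc i) a}"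
    and disj: "\<forall>i\<in>{1..N}. \<forall>j\<in>{1..N}. 1 < (if i \<le> j then j - i else i - j) \<longrightarrow>
         S i ` \<gamma> \<inter> S j ` \<gamma> = {}"
    using assms unfolding IFS_arc_def by blast
  have inv: "IFS_invariant N S \<gamma>" and ends: "S 1 a = a" "S N b = b"
    and junction: "\<forall>i\<in>{1..N-1}. S i b = S (Suc i) a"
    using path unfolding IFS_path_def by auto
  show ?thesis
  proof (cases "a = b")
    case True
    \<comment> \<open>\<open>S (Suc n) a = S n b = S n a\<close>, so all maps fix \<open>a\<close>
      and \<gamma> is a point. Condition (1) is then vacuous, as no
      \<open>U \<inter> \<gamma>\<close> has positive diameter.\<close>
    have "S i a = a" if "i \<in> {1..N}" for i
    proof -
      have "1 \<le> i" "i \<le> N" using that by auto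
      then show ?thesis
      proof (induction i rule: dec_induct)
        case (step n)
        then have "S (Suc n) a = S n b" using junction by simp
        then show ?case using step True by simp
      qed (rule ends(1))
    qed
    then have \<gamma>: "\<gamma> = {a}" by (rule IFS_invariant_singleton[OF inv])
    have "bounded_turning \<gamma>" unfolding bounded_turning_def \<gamma> by (intro exI[of _ 1]) auto
    moreover have "diameter (U \<inter> \<gamma>) = 0" for U
      unfolding \<gamma> by (cases "a \<in> U") (auto simp: Int_insert_right)
    then have ?expand using zero_less_one by (metis less_irrefl)
    moreover have ?embed unfolding \<gamma> by (intro exI[of _ 1] conjI) (auto intro!: exI[of _ id])
    ultimately show ?thesis by blast
  next
    case False
    have "\<exists>r. \<forall>i\<in>{1..N}. 0 < r i \<and> r i < 1 \<and> (\<forall>x y. dist (S i x) (S i y) = r i * dist x y)"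
      using inv unfolding IFS_invariant_def contracting_similarity_def by (intro bchoice) auto
    then obtain r where r: "\<And>i. i \<in> {1..N} \<Longrightarrow> 0 < r i"
      "\<And>i. i \<in> {1..N} \<Longrightarrow> r i < 1"
      "\<And>i x y. i \<in> {1..N} \<Longrightarrow> dist (S i x) (S i y) = r i * dist x y" by blast
    interpret nondegenerate_IFS_arc N S \<gamma> a b r
    proof
      show "2 \<le> N" "compact \<gamma>" "\<gamma> \<noteq> {}" "\<gamma> = (\<Union>i\<in>{1..N}. S i ` \<gamma>)"
        using inv unfolding IFS_invariant_def by auto
      show "S i ` \<gamma> \<inter> S j ` \<gamma> = {}" if "i \<in> {1..N}" "j \<in> {1..N}" "Suc i < j" for i j
        using disj that by simp
    qed (use r ends junction adj False in auto)
    obtain C r1 where C: "0 < C" "0 < r1" "\<And>x s. \<lbrakk>x \<in> \<gamma>; 0 < s; s < r1\<rbrakk> \<Longrightarrow>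
      \<exists>\<psi>. \<psi> ` \<gamma> \<subseteq> ball x s \<inter> \<gamma> \<and> (\<forall>u\<in>\<gamma>. \<forall>v\<in>\<gamma>. C * s * dist u v \<le> dist (\<psi> u) (\<psi> v))"
      using ball_contains_similar_copy by blast
    have ?embed
    proof (rule exI[of _ r1], rule conjI[OF C(2)], rule exI[of _ C], rule conjI[OF C(1)],
        intro ballI allI impI)
      fix x s assume "x \<in> \<gamma>" "0 < s \<and> s < r1"
      then show "\<exists>\<psi>. \<psi> ` \<gamma> \<subseteq> ball x s \<inter> \<gamma> \<and>
          (\<forall>u\<in>\<gamma>. \<forall>v\<in>\<gamma>. dist (\<psi> u) (\<psi> v) \<ge> C * s * dist u v)"
        using C(3)[of x s] by blast
    qed
    moreover have ?expand if turning: "bounded_turning \<gamma>"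
    proof -
      obtain B where "0 < B" "junction_turning B"
        using bounded_turning_imp_junction_turning[OF turning] by blast
      then obtain C1 C2 where c: "0 < C1" "0 < C2"
        and bu: "\<And>W. \<lbrakk>W \<subseteq> \<gamma>; 0 < diameter W\<rbrakk> \<Longrightarrow> blows_up W C1 C2"
        using junction_turning_imp_blows_up by blast
      show ?thesis
      \<comment> \<open>The value \<open>1\<close> for \<open>r0\<close> is arbitrary:
        \<open>bu\<close> covers all subsets of positive diameter.\<close>
      proof (rule exI[of _ 1], rule conjI[OF zero_less_one], rule exI[of _ C1],
          rule conjI[OF c(1)], rule exI[of _ C2], rule conjI[OF c(2)], intro allI impI)
        fix U :: "'a set"
        assume "open U \<and> U \<inter> \<gamma> \<noteq> {} \<and> 0 < diameter (U \<inter> \<gamma>) \<and> diameter (U \<inter> \<gamma>) < 1"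
        then show "\<exists>\<phi>. \<phi> ` (U \<inter> \<gamma>) \<subseteq> \<gamma> \<and>
          (\<forall>a\<in>U \<inter> \<gamma>. \<forall>b\<in>U \<inter> \<gamma>.
             C1 * dist a b / diameter (U \<inter> \<gamma>) \<le> dist (\<phi> a) (\<phi> b) \<and>
             dist (\<phi> a) (\<phi> b) \<le> C2 * dist a b / diameter (U \<inter> \<gamma>))"
          using bu[of "U \<inter> \<gamma>"] unfolding blows_up_def by blast
      qed
    qed
    moreover have "bounded_turning \<gamma>" if expand: ?expand
    proof -
      let ?P = "\<lambda>r0 C1 C2. \<forall>U. open U \<and> U \<inter> \<gamma> \<noteq> {} \<and>
        0 < diameter (U \<inter> \<gamma>) \<and> diameter (U \<inter> \<gamma>) < r0 \<longrightarrow> blows_up (U \<inter> \<gamma>) C1 C2"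
      have "\<exists>r0>0. \<exists>C1>0. \<exists>C2>0. ?P r0 C1 C2"
        using expand unfolding blows_up_def .
      then obtain r0 C1 C2 where c: "0 < r0" "0 < C1" "0 < C2" and U: "?P r0 C1 C2"
        by (elim exE conjE)
      have "blows_up (U \<inter> \<gamma>) C1 C2"
        if "open U" "0 < diameter (U \<inter> \<gamma>)" "diameter (U \<inter> \<gamma>) < r0" for U
      proof -
        have "U \<inter> \<gamma> \<noteq> {}" using that(2) by auto
        then show ?thesis using U that by blast
      qed
      then obtain B where "0 < B" "junction_turning B"
        using blows_up_imp_junction_turning[OF c] by blast
      then show ?thesis using junction_turning_imp_bounded_turning by blast
    qed
    ultimately show ?thesis by blast
  qed
qed

end
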